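(* Let $m\ge n$, $1\le k\le n$, and let $\Vert\cdot\Vert_{(k)}:\mathbb{DR}^{m\times n}\to\mathbb{DR}$ be the dual continuation of the Ky Fan $k$-norm on $\mathbb{R}^{m\times n}$. Let $\boldsymbol{A}=\boldsymbol{A}_{\rm s}+\boldsymbol{A}_{\rm i}\epsilon\in\mathbb{DR}^{m\times n}$. If $\boldsymbol{A}_{\rm s}\ne\boldsymbol{O}$, let the singular values of $\boldsymbol{A}_{\rm s}$ satisfy $$\sigma_1\ge\cdots\ge\sigma_{k-t}>\sigma_{k-t+1}=\cdots=\sigma_k=\cdots=\sigma_{k+s}>\sigma_{k+s+1}\ge\cdots\ge\sigma_n,$$ let $\boldsymbol{A}_{\rm s}=\boldsymbol{U}\boldsymbol{\Sigma}\boldsymbol{V}^\top$ be a full SVD, and put $\boldsymbol{U}_1=\boldsymbol{U}(:,1:k-t)$, $\boldsymbol{U}_2=\boldsymbol{U}(:,k-t+1:k+s)$, $\widetilde{\boldsymbol{U}}_1=\boldsymbol{U}(:,k-t+1:m)$, $\boldsymbol{V}_1=\boldsymbol{V}(:,1:k-t)$, $\boldsymbol{V}_2=\boldsymbol{V}(:,k-t+1:k+s)$, $\boldsymbol{M}=\mathrm{sym}(\boldsymbol{U}_2^\top\boldsymbol{A}_{\rm i}\boldsymbol{V}_2)$ with eigenvalues $\lambda_1(\boldsymbol{M})\ge\cdots\ge\lambda_{t+s}(\boldsymbol{M})$, and $\boldsymbol{N}=\widetilde{\boldsymbol{U}}_1^\top\boldsymbol{A}_{\rm i}\boldsymbol{V}_2$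 with singular values $\sigma_1(\boldsymbol{N})\ge\cdots\ge\sigma_{t+s}(\boldsymbol{N})$. Then $$\Vert\boldsymbol{A}\Vert_{(k)}=\begin{cases}\Vert\boldsymbol{A}_{\rm s}\Vert_{(k)}+\big(\langle\boldsymbol{U}_1\boldsymbol{V}_1^\top,\boldsymbol{A}_{\rm i}\rangle+\sum_{\ell=1}^t\lambda_\ell(\boldsymbol{M})\big)\epsilon, & \boldsymbol{A}_{\rm s}\ne\boldsymbol{O},\ \sigma_k\neq0,\\ \Vert\boldsymbol{A}_{\rm s}\Vert_{(k)}+\big(\langle\boldsymbol{U}_1\boldsymbol{V}_1^\top,\boldsymbol{A}_{\rm i}\rangle+\sum_{\ell=1}^t\sigma_\ell(\boldsymbol{N})\big)\epsilon, & \boldsymbol{A}_{\rm s}\ne\boldsymbol{O},\ \sigma_k=0,\\ \Vert\boldsymbol{A}_{\rm i}\Vert_{(k)}\,\epsilon, & \boldsymbol{A}_{\rm s}=\boldsymbol{O}.\end{cases}$$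
   Context: Dual numbers: $\mathbb{DR}=\{p_{\rm s}+p_{\rm i}\epsilon: p_{\rm s},p_{\rm i}\in\mathbb{R}\}$ with $\epsilon\neq0$, $\epsilon^2=0$. Dual matrices are written $\boldsymbol{A}=\boldsymbol{A}_{\rm s}+\boldsymbol{A}_{\rm i}\epsilon$ with $\boldsymbol{A}_{\rm s},\boldsymbol{A}_{\rm i}$ real. Gâteaux derivative: $\mathcal{D}_u\phi(x)=\lim_{t\downarrow0}\frac{\phi(x+tu)-\phi(x)}{t}$. The dual continuation of a real-valued function $\phi$ on a real space $\mathcal{X}$ is $\tilde\phi(a+b\epsilon)=\phi(a)+\mathcal{D}_b\phi(a)\,\epsilon$ for $a,b\in\mathcal{X}$; the dual continuation of a norm is denoted by the same symbol. For $\boldsymbol{X}\in\mathbb{R}^{m\times n}$ with singular values $\sigma_1\ge\cdots\ge\sigma_n$, the Ky Fan $k$-norm is $\Vert\boldsymbol{X}\Vert_{(k)}=\sum_{i=1}^k\sigma_i$. In the displayed chain of singular values, $t\ge1$ and $s\ge0$ are the integers such that $\{k-t+1,\dots,k+s\}$ is the set of all indices $j$ with $\sigma_j=\sigma_k$ (the parts of the chain before or after may be empty; terms with empty matrices are zero). A full SVD has $\boldsymbol{U}\in\mathbb{R}^{m\times m}$, $\boldsymbol{V}\in\mathbb{R}^{n\times n}$ orthogonal and $\boldsymbol{\Sigma}\in\mathbb{R}^{m\times n}$ diagonal with the singular values in nonincreasing order. $\boldsymbol{U}(:,a:b)$ denotes columns $a$ through $b$. $\mathrm{sym}(\boldsymbol{X})=\frac12(\boldsymbol{X}+\boldsymbol{X}^\top)$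 and $\langle\boldsymbol{X},\boldsymbol{Y}\rangle=\mathrm{tr}(\boldsymbol{X}^\top\boldsymbol{Y})$. *)

theory Defs
  imports Complex_Main "Jordan_Normal_Form.Char_Poly"
begin

section \<open>Dual numbers\<close>

datatype dual = Dual (st: real) (nst: real)

lemma dual_eq_iff: "p = q \<longleftrightarrow> st p = st q \<and> nst p = nst q"
  by (cases p; cases q) simp

instantiation dual :: "{comm_ring_1, real_algebra_1}"
begin

definition zero_dual :: dual where "0 = Dual 0 0"
definition one_dual :: dual where "1 = Dual 1 0"
definition plus_dual :: "dual \<Rightarrow> dual \<Rightarrow> dual" where
  "p + q = Dual (st p + st q) (nst p + nst q)"
definition minus_dual :: "dual \<Rightarrow> dual \<Rightarrow> dual" where
  "p - q = Dual (st p - st q) (nst p - nst q)"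
definition uminus_dual :: "dual \<Rightarrow> dual" where
  "- p = Dual (- st p) (- nst p)"
definition times_dual :: "dual \<Rightarrow> dual \<Rightarrow> dual" where
  "p * q = Dual (st p * st q) (st p * nst q + nst p * st q)"
definition scaleR_dual :: "real \<Rightarrow> dual \<Rightarrow> dual" where
  "scaleR r p = Dual (r * st p) (r * nst p)"

instance
  by standard
    (simp_all add: dual_eq_iff zero_dual_def one_dual_def plus_dual_def minus_dual_def
      uminus_dual_def times_dual_def scaleR_dual_def algebra_simps)

end

definition eps :: dual (\<open>\<epsilon>\<close>) where
  "\<epsilon> = Dual 0 1"

lemma eps_neq_0: "\<epsilon> \<noteq> 0"
  by (simp add: eps_def zero_dual_def)

lemma eps_square: "\<epsilon> ^ 2 = 0"
  by (simp add: eps_def zero_dual_def times_dual_def power2_eq_square)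

lemma Dual_eq: "Dual a b = of_real a + of_real b * \<epsilon>"
  by (simp add: of_real_def scaleR_dual_def one_dual_def eps_def plus_dual_def times_dual_def)

abbreviation st_mat :: "dual mat \<Rightarrow> real mat" where
  "st_mat A \<equiv> map_mat st A"

abbreviation nst_mat :: "dual mat \<Rightarrow> real mat" where
  "nst_mat A \<equiv> map_mat nst A"


section \<open>Gateaux derivative and dual continuation\<close>

text \<open>The real space is that of real matrices of a fixed size. Since the type of matrices
  contains all sizes, it is not a \<open>real_vector\<close>, and the quotient is written with the matrix
  operations. \<open>Lim\<close> is unspecified if the limit does not exist, whence the separate predicate
  for existence.\<close>

definition gateaux_quotient :: "(real mat \<Rightarrow> real) \<Rightarrow> real mat \<Rightarrow> real mat \<Rightarrow> real \<Rightarrow> real" where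
  "gateaux_quotient \<phi> U X t = (\<phi> (X + t \<cdot>\<^sub>m U) - \<phi> X) / t"

definition gateaux_exists :: "(real mat \<Rightarrow> real) \<Rightarrow> real mat \<Rightarrow> real mat \<Rightarrow> bool" where
  "gateaux_exists \<phi> U X \<longleftrightarrow> (\<exists>L. (gateaux_quotient \<phi> U X \<longlongrightarrow> L) (at_right 0))"

definition gateaux_deriv :: "(real mat \<Rightarrow> real) \<Rightarrow> real mat \<Rightarrow> real mat \<Rightarrow> real" where
  "gateaux_deriv \<phi> U X = Lim (at_right 0) (gateaux_quotient \<phi> U X)"

definition dual_continuation :: "(real mat \<Rightarrow> real) \<Rightarrow> dual mat \<Rightarrow> dual" where
  "dual_continuation \<phi> A =
     of_real (\<phi> (st_mat A)) + of_real (gateaux_deriv \<phi> (nst_mat A) (st_mat A)) * \<epsilon>"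


section \<open>Eigenvalues, singular values and the Ky Fan norm\<close>

text \<open>Real eigenvalues with algebraic multiplicity, nonincreasing, numbered from 1. For a
  symmetric matrix of size \<open>n\<close> these are all \<open>n\<close> eigenvalues.\<close>

definition eigenvalue_desc :: "real mat \<Rightarrow> nat \<Rightarrow> real" where
  "eigenvalue_desc M l = rev (sorted_list_of_multiset (proots (char_poly M))) ! (l - 1)"

text \<open>Numbered from 1 up to the number of columns; only used for matrices with at least as
  many rows as columns.\<close>

definition singular_value :: "real mat \<Rightarrow> nat \<Rightarrow> real" where
  "singular_value X j = sqrt (eigenvalue_desc (X\<^sup>T * X) j)"

definition ky_fan_norm :: "nat \<Rightarrow> real mat \<Rightarrow> real" where
  "ky_fan_norm k X = (\<Sum>i = 1..k. singular_value X i)"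


section \<open>Full singular value decomposition and matrix notation\<close>

text \<open>The library's \<open>orthogonal_mat\<close> only requires the columns to be nonzero and pairwise
  orthogonal.\<close>

definition orthonormal_mat :: "nat \<Rightarrow> real mat \<Rightarrow> bool" where
  "orthonormal_mat n Q \<longleftrightarrow> Q \<in> carrier_mat n n \<and> Q\<^sup>T * Q = 1\<^sub>m n \<and> Q * Q\<^sup>T = 1\<^sub>m n"

text \<open>Matrix entries are numbered from 0, singular values from 1.\<close>

definition full_svd :: "nat \<Rightarrow> nat \<Rightarrow> real mat \<Rightarrow> real mat \<Rightarrow> real mat \<Rightarrow> real mat \<Rightarrow> bool" where
  "full_svd m n X U S V \<longleftrightarrow>
     orthonormal_mat m U \<and> orthonormal_mat n V \<and>
     S \<in> carrier_mat m n \<and> diagonal_mat S \<and>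
     (\<forall>j < min m n. S $$ (j, j) = singular_value X (j + 1)) \<and>
     X = U * S * V\<^sup>T"

text \<open>The columns \<open>a\<close> through \<open>b\<close>, numbered from 1; no columns if \<open>b < a\<close>.\<close>

definition col_range :: "real mat \<Rightarrow> nat \<Rightarrow> nat \<Rightarrow> real mat" where
  "col_range X a b = mat_of_cols (dim_row X) (map (\<lambda>j. col X (j - 1)) [a ..< b + 1])"

definition sym_part :: "real mat \<Rightarrow> real mat" where
  "sym_part X = (1 / 2) \<cdot>\<^sub>m (X + X\<^sup>T)"

definition trace_mat :: "real mat \<Rightarrow> real" where
  "trace_mat X = (\<Sum>i < dim_row X. X $$ (i, i))"

definition mat_inner :: "real mat \<Rightarrow> real mat \<Rightarrow> real" where
  "mat_inner X Y = trace_mat (X\<^sup>T * Y)"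

end

theory Submission
  imports Defs
begin

text \<open>
  The Ky Fan \<open>k\<close>-norm is a maximum of linear functions: \<open>\<parallel>X\<parallel>\<^sub>k\<close> is the largest value of
  \<open>tr (P\<^sup>T X Q)\<close> over all pairs of contractions \<open>P\<close> and \<open>Q\<close> with \<open>k\<close> columns
  (lemmas \<open>trace_pairing_le_ky_fan_norm\<close> and \<open>ky_fan_norm_attained\<close>). Its directional derivative
  is therefore the largest slope among the linear functions that are maximal at the base point, and the
  proof makes this quantitative instead of appealing to compactness.

  The norm is invariant under orthogonal factors, so a full singular value decomposition
  \<open>X = U S V\<^sup>T\<close> reduces the problem to \<open>S + \<tau> B\<close> with \<open>B = U\<^sup>T H V\<close> and \<open>S\<close> diagonal with entries \<open>\<sigma>\<^sub>i\<close>.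
  Write \<open>p\<^sub>i\<close> and \<open>q\<^sub>j\<close> for the rows of \<open>P\<close> and \<open>Q\<close>; the value of the pair at \<open>S + \<tau> B\<close> is
  \<open>\<Sum>\<^sub>i \<sigma>\<^sub>i \<langle>p\<^sub>i, q\<^sub>i\<rangle> + \<tau> \<Sum>\<^sub>i\<^sub>j B\<^sub>i\<^sub>j \<langle>p\<^sub>i, q\<^sub>j\<rangle>\<close>. The indices fall into the first block \<open>i < r\<close>, where
  \<open>\<sigma>\<^sub>i\<close> exceeds the level \<open>h\<close>, the \<open>k\<close>-th of these entries, the middle block \<open>r \<le> i < q\<close>, where it equals \<open>h\<close>, and the rest.

  \<^item> Lower bound: \<open>P\<close> and \<open>Q\<close> that are the identity on the first block, combined with the top eigenvectors
    of \<open>M\<close> or with an optimal pair for \<open>N\<close>, are maximal at \<open>S\<close> and have the claimed slope.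
  \<^item> Upper bound: any pair falls short of \<open>\<parallel>S\<parallel>\<^sub>k\<close> at \<open>S\<close> by at least a multiple \<open>c d\<close> of a number
    \<open>d \<ge> 0\<close>, called its deviation (\<open>diagonal_loss\<close>). A pair of deviation \<open>d\<close> has \<open>\<langle>p\<^sub>i, q\<^sub>j\<rangle>\<close> within
    \<open>O(d + \<surd>d)\<close> of the Kronecker symbol whenever \<open>i\<close> or \<open>j\<close> is in the first block. On what remains,
    the maximum principle for the eigenvalues of \<open>M\<close>, if \<open>h > 0\<close>, or for the singular values of \<open>N\<close>, if
    \<open>h = 0\<close>, applies. So the slope is at most the claimed one plus \<open>C (d + \<surd>d)\<close>
    (\<open>positive_level_bound\<close>, \<open>zero_level_bound\<close>). In the sum
    \<open>\<tau> C (d + \<surd>d) - c d\<close> the gain is absorbed by the loss up to \<open>O(\<tau>\<^sup>2)\<close> (\<open>quadratic_absorbs\<close>).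

  The two bounds squeeze the difference quotient. The two cases differ for the following reason. If
  \<open>h > 0\<close>, near-optimality also forces \<open>p\<^sub>i\<close> to be close to \<open>q\<^sub>i\<close> in the middle block and the rows \<open>p\<^sub>i\<close> with
  \<open>i \<ge> q\<close> to be short, so only the symmetric part of the middle block of \<open>B\<close> counts.
  If \<open>h = 0\<close>, the singular value gives no such control: \<open>p\<^sub>i\<close> for \<open>r \<le> i < m\<close> and \<open>q\<^sub>j\<close> for \<open>r \<le> j < n\<close> are independent, and a rectangular
  block remains.
\<close>

section \<open>Contractions and pairings with a matrix\<close>

text \<open>Vectors and matrices are represented by functions with explicit sizes here: the estimates work
  on single rows and entries and on index blocks, and ranges of indices are easier to split than
  carriers.\<close>

definition dot :: "nat \<Rightarrow> (nat \<Rightarrow> real) \<Rightarrow> (nat \<Rightarrow> real) \<Rightarrow> real" where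
  "dot k x y = (\<Sum>l<k. x l * y l)"

lemma dot_commute: "dot k x y = dot k y x"
  by (simp add: dot_def mult.commute)

lemma dot_self_nonneg: "0 \<le> dot k x x"
  by (simp add: dot_def sum_nonneg)

lemma dot_diff_left: "dot k (\<lambda>l. x l - y l) z = dot k x z - dot k y z"
  by (simp add: dot_def left_diff_distrib sum_subtractf)

lemma dot_diff_self: "dot k (\<lambda>l. x l - y l) (\<lambda>l. x l - y l) = dot k x x - 2 * dot k x y + dot k y y"
  by (simp add: dot_def algebra_simps sum.distrib sum_subtractf sum_distrib_left)

lemma dot_scale_left: "dot k (\<lambda>l. a * x l) y = a * dot k x y"
  by (simp add: dot_def sum_distrib_left mult.assoc)

lemma dot_scale_right: "dot k x (\<lambda>l. a * y l) = a * dot k x y"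
  by (simp add: dot_def sum_distrib_left mult_ac)

lemma dot_le_mean: "dot k x y \<le> (dot k x x + dot k y y) / 2"
  using dot_self_nonneg[of k "\<lambda>l. x l - y l"] by (simp add: dot_diff_self)

lemma dot_Cauchy_Schwarz: "(dot k x y)\<^sup>2 \<le> dot k x x * dot k y y"
proof (cases "dot k y y = 0")
  case True
  then have "\<forall>l<k. y l = 0"
    by (simp add: dot_def sum_nonneg_eq_0_iff)
  then have "dot k x y = 0" by (simp add: dot_def)
  then show ?thesis using True by simp
next
  case False
  then have pos: "dot k y y > 0" using dot_self_nonneg[of k y] by linarith
  let ?a = "dot k x y / dot k y y"
  have "0 \<le> dot k (\<lambda>l. x l - ?a * y l) (\<lambda>l. x l - ?a * y l)" by (rule dot_self_nonneg)
  also have "\<dots> = dot k x x - 2 * (?a * dot k x y) + ?a * (?a * dot k y y)"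
    by (simp only: dot_diff_self dot_scale_left dot_scale_right)
  also have "\<dots> = dot k x x - (dot k x y)\<^sup>2 / dot k y y"
    using pos by (simp add: field_simps power2_eq_square)
  finally show ?thesis using pos by (simp add: field_simps)
qed

lemma abs_dot_le: 
  assumes "dot k x x \<le> a" "dot k y y \<le> 1" 
  shows "\<bar>dot k x y\<bar> \<le> sqrt a"
proof -
  have "(dot k x y)\<^sup>2 \<le> dot k x x * dot k y y" by (rule dot_Cauchy_Schwarz)
  also have "\<dots> \<le> a * 1" using assms dot_self_nonneg[of k x] dot_self_nonneg[of k y]
    by (intro mult_mono) auto
  finally show ?thesis by (simp add: real_le_rsqrt)
qed

text \<open>The adjoint relation \<open>\<langle>x, P y\<rangle> = \<langle>P\<^sup>T x, y\<rangle>\<close>; \<open>P i\<close> is the row \<open>i\<close> of \<open>P\<close>.\<close>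

lemma dot_transpose: "dot m x (\<lambda>i. dot k (P i) y) = dot k (\<lambda>l. dot m (\<lambda>i. P i l) x) y"
  unfolding dot_def by (simp add: sum_distrib_left sum_distrib_right mult_ac) (rule sum.swap)

text \<open>An \<open>m \<times> k\<close> matrix with operator norm at most 1. Other than matrices with orthonormal
  columns, contractions may have zero columns, so singular vectors for the singular value 0 need no
  orthonormal completion in Ky Fan's principle.\<close>

definition contraction :: "nat \<Rightarrow> nat \<Rightarrow> (nat \<Rightarrow> nat \<Rightarrow> real) \<Rightarrow> bool" where
  "contraction m k P \<longleftrightarrow> (\<forall>c. (\<Sum>i<m. (dot k (P i) c)\<^sup>2) \<le> dot k c c)"

lemma contractionD: "contraction m k P \<Longrightarrow> (\<Sum>i<m. (dot k (P i) c)\<^sup>2) \<le> dot k c c"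
  by (simp add: contraction_def)

text \<open>With \<open>y = P\<^sup>T c\<close>, the adjoint relation and the Cauchy-Schwarz inequality give
  \<open>\<bar>y\<bar>\<^sup>4 = \<langle>c, P y\<rangle>\<^sup>2 \<le> \<bar>c\<bar>\<^sup>2 \<bar>P y\<bar>\<^sup>2 \<le> \<bar>c\<bar>\<^sup>2 \<bar>y\<bar>\<^sup>2\<close>.\<close>

lemma contraction_transpose:
  assumes P: "contraction m k P"
  shows "contraction k m (\<lambda>l i. P i l)"
  unfolding contraction_def
proof
  fix c
  define y where "y = (\<lambda>l. dot m (\<lambda>i. P i l) c)"
  have "dot k y y = dot m c (\<lambda>i. dot k (P i) y)"
    by (subst dot_transpose) (simp only: y_def)
  then have "(dot k y y)\<^sup>2 \<le> dot m c c * dot m (\<lambda>i. dot k (P i) y) (\<lambda>i. dot k (P i) y)"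
    using dot_Cauchy_Schwarz[of m c] by metis
  also have "\<dots> \<le> dot m c c * dot k y y"
    using contractionD[OF P, of y] dot_self_nonneg[of m c]
    by (intro mult_left_mono) (auto simp: dot_def[of m] power2_eq_square)
  finally have *: "(dot k y y)\<^sup>2 \<le> dot m c c * dot k y y" .
  have "dot k y y \<le> dot m c c"
  proof (cases "dot k y y = 0")
    case True then show ?thesis by (simp add: dot_self_nonneg)
  next
    case False
    then have "dot k y y > 0" using dot_self_nonneg[of k y] by linarith
    with * show ?thesis by (simp add: power2_eq_square)
  qed
  then show "(\<Sum>l<k. (dot m (\<lambda>i. P i l) c)\<^sup>2) \<le> dot m c c"
    by (simp add: dot_def[of k] y_def power2_eq_square)
qed

lemma contraction_compose:
  assumes P: "contraction m k P" and Q: "contraction k r Q"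
  shows "contraction m r (\<lambda>i j. dot k (P i) (\<lambda>l. Q l j))"
  unfolding contraction_def
proof
  fix c
  have "dot r (\<lambda>j. dot k (P i) (\<lambda>l. Q l j)) c = dot k (P i) (\<lambda>l. dot r (Q l) c)" for i
    by (subst dot_transpose) (simp add: dot_commute)
  then have "(\<Sum>i<m. (dot r (\<lambda>j. dot k (P i) (\<lambda>l. Q l j)) c)\<^sup>2) =
      (\<Sum>i<m. (dot k (P i) (\<lambda>l. dot r (Q l) c))\<^sup>2)" by simp
  also have "\<dots> \<le> dot k (\<lambda>l. dot r (Q l) c) (\<lambda>l. dot r (Q l) c)"
    by (rule contractionD[OF P])
  also have "\<dots> = (\<Sum>l<k. (dot r (Q l) c)\<^sup>2)" by (simp add: dot_def[of k] power2_eq_square)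
  also have "\<dots> \<le> dot r c c" by (rule contractionD[OF Q])
  finally show "(\<Sum>i<m. (dot r (\<lambda>j. dot k (P i) (\<lambda>l. Q l j)) c)\<^sup>2) \<le> dot r c c" .
qed

lemma contraction_rows:
  assumes P: "contraction m k P" and "r + s \<le> m"
  shows "contraction s k (\<lambda>i. P (r + i))"
  unfolding contraction_def
proof
  fix c
  have "(\<Sum>i<s. (dot k (P (r + i)) c)\<^sup>2) = (\<Sum>i\<in>(\<lambda>i. r + i) ` {..<s}. (dot k (P i) c)\<^sup>2)"
    by (simp add: sum.reindex)
  also have "\<dots> \<le> (\<Sum>i<m. (dot k (P i) c)\<^sup>2)"
    using assms(2) by (intro sum_mono2) auto
  also have "\<dots> \<le> dot k c c" by (rule contractionD[OF P])
  finally show "(\<Sum>i<s. (dot k (P (r + i)) c)\<^sup>2) \<le> dot k c c" .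
qed

text \<open>The contraction property applied to a row of \<open>P\<close>, that is, \<open>(P P\<^sup>T)\<^sup>2 \<le> P P\<^sup>T\<close> on the diagonal. It
  bounds all entries of \<open>P P\<^sup>T\<close> by the diagonal ones.\<close>

lemma contraction_gram:
  assumes "contraction m k P"
  shows "(\<Sum>b<m. (dot k (P a) (P b))\<^sup>2) \<le> dot k (P a) (P a)"
  using contractionD[OF assms, of "P a"] by (simp add: dot_commute)

lemma contraction_row_le_1:
  assumes "contraction m k P" "a < m"
  shows "dot k (P a) (P a) \<le> 1"
proof -
  have "(dot k (P a) (P a))\<^sup>2 \<le> (\<Sum>b<m. (dot k (P a) (P b))\<^sup>2)"
    using assms(2) by (intro member_le_sum) auto
  with contraction_gram[OF assms(1), of a] have "dot k (P a) (P a) * dot k (P a) (P a) \<le> dot k (P a) (P a) * 1"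
    by (simp add: power2_eq_square)
  then show ?thesis using dot_self_nonneg[of k "P a"]
    by (cases "dot k (P a) (P a) = 0") (auto simp: mult_le_cancel_left)
qed

text \<open>A row of length almost 1 is almost orthogonal to the others: if \<open>x\<close> is the squared length of row \<open>a\<close>, then
  \<open>contraction_gram\<close> leaves at most \<open>x - x\<^sup>2 \<le> 1 - x\<close> for the squared off-diagonal entries.\<close>

lemma contraction_offdiag:
  assumes "contraction m k P" "a < m" "b < m" "a \<noteq> b"
  shows "(dot k (P a) (P b))\<^sup>2 \<le> 1 - dot k (P a) (P a)"
proof -
  let ?a = "dot k (P a) (P a)"
  have "(\<Sum>i\<in>{a, b}. (dot k (P a) (P i))\<^sup>2) \<le> (\<Sum>i<m. (dot k (P a) (P i))\<^sup>2)"
    using assms by (intro sum_mono2) auto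
  also have "\<dots> \<le> ?a" by (rule contraction_gram[OF assms(1)])
  finally have "?a\<^sup>2 + (dot k (P a) (P b))\<^sup>2 \<le> ?a" using assms(4) by simp
  moreover have "?a - ?a\<^sup>2 \<le> 1 - ?a"
    using zero_le_power2[of "1 - ?a"] by (simp add: power2_eq_square algebra_simps)
  ultimately show ?thesis by linarith
qed

text \<open>The \<open>k\<close> columns have length at most 1.\<close>

lemma contraction_frobenius:
  assumes P: "contraction m k P"
  shows "(\<Sum>i<m. dot k (P i) (P i)) \<le> real k"
proof -
  have "(\<Sum>i<m. dot k (P i) (P i)) = (\<Sum>l<k. dot m (\<lambda>i. P i l) (\<lambda>i. P i l))"
    unfolding dot_def by (rule sum.swap)
  also have "\<dots> \<le> (\<Sum>l<k. 1)"
    using contraction_row_le_1[OF contraction_transpose[OF P]] by (intro sum_mono) auto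
  finally show ?thesis by simp
qed

lemma contraction_frobenius_compose:
  assumes Q: "contraction n m Q"
  shows "(\<Sum>i<n. \<Sum>j<k. (dot m (Q i) (\<lambda>l. P l j))\<^sup>2) \<le> (\<Sum>l<m. dot k (P l) (P l))"
proof -
  have "(\<Sum>i<n. \<Sum>j<k. (dot m (Q i) (\<lambda>l. P l j))\<^sup>2) = (\<Sum>j<k. \<Sum>i<n. (dot m (Q i) (\<lambda>l. P l j))\<^sup>2)"
    by (rule sum.swap)
  also have "\<dots> \<le> (\<Sum>j<k. dot m (\<lambda>l. P l j) (\<lambda>l. P l j))"
    by (intro sum_mono contractionD[OF Q])
  also have "\<dots> = (\<Sum>l<m. dot k (P l) (P l))" unfolding dot_def by (rule sum.swap)
  finally show ?thesis .
qed

lemma contractionI_orthogonal_columns: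
  assumes "\<And>l l'. l < k \<Longrightarrow> l' < k \<Longrightarrow> l \<noteq> l' \<Longrightarrow> dot m (\<lambda>i. P i l) (\<lambda>i. P i l') = 0"
    and "\<And>l. l < k \<Longrightarrow> dot m (\<lambda>i. P i l) (\<lambda>i. P i l) \<le> 1"
  shows "contraction m k P"
  unfolding contraction_def
proof
  fix c
  have "(\<Sum>i<m. (dot k (P i) c)\<^sup>2) = dot m (\<lambda>i. dot k (P i) c) (\<lambda>i. dot k (P i) c)"
    by (simp add: dot_def[of m] power2_eq_square)
  also have "\<dots> = dot k (\<lambda>l. dot m (\<lambda>i. P i l) (\<lambda>i. dot k (P i) c)) c"
    by (rule dot_transpose)
  also have "\<dots> = (\<Sum>l<k. (\<Sum>l'<k. dot m (\<lambda>i. P i l') (\<lambda>i. P i l) * c l') * c l)"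
    by (simp add: dot_transpose) (simp add: dot_def[of k])
  also have "\<dots> = (\<Sum>l<k. (dot m (\<lambda>i. P i l) (\<lambda>i. P i l) * c l) * c l)"
  proof (intro sum.cong refl, goal_cases)
    case (1 l)
    have "(\<Sum>l'<k. dot m (\<lambda>i. P i l') (\<lambda>i. P i l) * c l') =
      (\<Sum>l'<k. if l' = l then dot m (\<lambda>i. P i l) (\<lambda>i. P i l) * c l else 0)"
      using 1 assms(1) by (intro sum.cong) auto
    then show ?case using 1 by simp
  qed
  also have "\<dots> \<le> (\<Sum>l<k. c l * c l)"
  proof (intro sum_mono, goal_cases)
    case (1 l)
    then show ?case
      using mult_right_mono[OF assms(2)[of l], of "c l * c l"] by (simp add: mult.assoc)
  qed
  finally show "(\<Sum>i<m. (dot k (P i) c)\<^sup>2) \<le> dot k c c" by (simp add: dot_def)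
qed

lemma sum_lessThan_add: "(\<Sum>i<r + s. f i) = (\<Sum>i<r. f i) + (\<Sum>i<s. f (r + i))"
  for f :: "nat \<Rightarrow> real"
  by (induction s) (simp_all add: add.assoc)

text \<open>The block diagonal matrix with the identity of size \<open>r\<close> and \<open>G\<close>. Optimal pairs for a diagonal
  matrix have this form.\<close>

definition block_id :: "nat \<Rightarrow> (nat \<Rightarrow> nat \<Rightarrow> real) \<Rightarrow> nat \<Rightarrow> nat \<Rightarrow> real" where
  "block_id r G i l = (if i < r then (if l = i then 1 else 0) else if l < r then 0 else G (i - r) (l - r))"

lemma dot_block_id:
  "i < r \<Longrightarrow> dot (r + t) (block_id r G i) c = c i"
  "dot (r + t) (block_id r G (r + i)) c = dot t (G i) (\<lambda>l. c (r + l))"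
  by (simp_all add: dot_def sum_lessThan_add block_id_def if_distrib[of "\<lambda>x. x * _"] sum.delta cong: if_cong)

lemma contraction_block_id:
  assumes G: "contraction m t G"
  shows "contraction (r + m) (r + t) (block_id r G)"
  unfolding contraction_def
proof
  fix c
  have "(\<Sum>i<r + m. (dot (r + t) (block_id r G i) c)\<^sup>2)
     = (\<Sum>i<r. (c i)\<^sup>2) + (\<Sum>i<m. (dot t (G i) (\<lambda>l. c (r + l)))\<^sup>2)"
    by (simp add: sum_lessThan_add dot_block_id)
  also have "\<dots> \<le> (\<Sum>i<r. (c i)\<^sup>2) + dot t (\<lambda>l. c (r + l)) (\<lambda>l. c (r + l))"
    using contractionD[OF G] by simp
  also have "\<dots> = dot (r + t) c c" by (simp add: dot_def sum_lessThan_add power2_eq_square)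
  finally show "(\<Sum>i<r + m. (dot (r + t) (block_id r G i) c)\<^sup>2) \<le> dot (r + t) c c" .
qed

text \<open>The trace of \<open>P\<^sup>T X Q\<close>, written with the inner products of the rows of \<open>P\<close> and \<open>Q\<close>.\<close>

definition trace_pairing :: "nat \<Rightarrow> nat \<Rightarrow> nat \<Rightarrow> (nat \<Rightarrow> nat \<Rightarrow> real) \<Rightarrow> (nat \<Rightarrow> nat \<Rightarrow> real) \<Rightarrow> (nat \<Rightarrow> nat \<Rightarrow> real) \<Rightarrow> real" where
  "trace_pairing m n k X P Q = (\<Sum>i<m. \<Sum>j<n. X i j * dot k (P i) (Q j))"

text \<open>Subtract \<open>a (t - 1)\<close> from all terms: the first \<open>t\<close> differences are nonnegative and weighted by at most 1,
  the others are nonpositive. The correction term for a total weight other than \<open>t\<close> is what later makes the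
  bound usable for the parts of \<open>P\<close> and \<open>Q\<close> in one block, whose size is only approximately \<open>t\<close>.\<close>

lemma weighted_sum_le_top_sum:
  fixes a c :: "nat \<Rightarrow> real"
  assumes anti: "\<And>i j. i \<le> j \<Longrightarrow> j < n \<Longrightarrow> a j \<le> a i"
    and c: "\<And>i. i < n \<Longrightarrow> 0 \<le> c i \<and> c i \<le> 1"
    and t: "1 \<le> t" "t \<le> n"
  shows "(\<Sum>l<n. a l * c l) \<le> (\<Sum>l<t. a l) + a (t - 1) * ((\<Sum>l<n. c l) - real t)"
proof -
  let ?b = "a (t - 1)"
  have "(\<Sum>l<n. a l * c l) - ?b * (\<Sum>l<n. c l) = (\<Sum>l<n. (a l - ?b) * c l)"
    by (simp add: sum_distrib_left sum_subtractf left_diff_distrib)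
  also have "\<dots> \<le> (\<Sum>l<n. if l < t then a l - ?b else 0)"
  proof (rule sum_mono, goal_cases)
    case (1 l)
    then have l: "l < n" by simp
    show ?case
    proof (cases "l < t")
      case True
      then have "a l - ?b \<ge> 0" using anti[of l "t - 1"] t by simp
      then show ?thesis using True c[OF l] mult_left_le[of "c l" "a l - ?b"] by simp
    next
      case False
      then have "a l - ?b \<le> 0" using anti[of "t - 1" l] l by simp
      then show ?thesis using False c[OF l] by (simp add: mult_nonpos_nonneg)
    qed
  qed
  also have "\<dots> = (\<Sum>l\<in>{..<n} \<inter> {l. l < t}. a l - ?b)"
    by (simp only: sum.inter_restrict finite_lessThan mem_Collect_eq)
  also have "{..<n} \<inter> {l. l < t} = {..<t}" using t by auto
  also have "(\<Sum>l<t. a l - ?b) = (\<Sum>l<t. a l) - real t * ?b" by (simp add: sum_subtractf)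
  finally show ?thesis by (simp add: algebra_simps)
qed

lemma trace_pairing_rank_one_expansion:
  assumes X: "\<And>i j. i < m \<Longrightarrow> j < n \<Longrightarrow> X i j = (\<Sum>l<N. s l * (u i l * v j l))"
  shows "trace_pairing m n k X P Q =
    (\<Sum>l<N. s l * dot k (\<lambda>c. dot m (\<lambda>i. u i l) (\<lambda>i. P i c)) (\<lambda>c. dot n (\<lambda>j. v j l) (\<lambda>j. Q j c)))"
proof -
  have inner: "dot k (\<lambda>c. dot m (\<lambda>i. u i l) (\<lambda>i. P i c)) (\<lambda>c. dot n (\<lambda>j. v j l) (\<lambda>j. Q j c))
      = (\<Sum>i<m. \<Sum>j<n. u i l * v j l * dot k (P i) (Q j))" (is "?L = ?R") for l
  proof -
    have "?L = (\<Sum>c<k. \<Sum>i<m. \<Sum>j<n. u i l * v j l * (P i c * Q j c))"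
      by (simp add: dot_def sum_product mult_ac)
    also have "\<dots> = (\<Sum>i<m. \<Sum>c<k. \<Sum>j<n. u i l * v j l * (P i c * Q j c))" by (rule sum.swap)
    also have "\<dots> = (\<Sum>i<m. \<Sum>j<n. \<Sum>c<k. u i l * v j l * (P i c * Q j c))"
      by (intro sum.cong refl sum.swap)
    finally show ?thesis by (simp add: dot_def sum_distrib_left)
  qed
  have "trace_pairing m n k X P Q = (\<Sum>i<m. \<Sum>j<n. \<Sum>l<N. s l * (u i l * v j l * dot k (P i) (Q j)))"
    unfolding trace_pairing_def by (intro sum.cong refl) (simp add: X, simp only: sum_distrib_right mult.assoc)
  also have "\<dots> = (\<Sum>i<m. \<Sum>l<N. \<Sum>j<n. s l * (u i l * v j l * dot k (P i) (Q j)))"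
    by (intro sum.cong refl sum.swap)
  also have "\<dots> = (\<Sum>l<N. \<Sum>i<m. \<Sum>j<n. s l * (u i l * v j l * dot k (P i) (Q j)))"
    by (rule sum.swap)
  finally show ?thesis by (simp add: inner sum_distrib_left)
qed

lemma contraction_transpose_mult_row_le_1:
  assumes u: "contraction m N u" and P: "contraction m k P" and l: "l < N"
  shows "dot k (\<lambda>c. dot m (\<lambda>i. u i l) (\<lambda>i. P i c)) (\<lambda>c. dot m (\<lambda>i. u i l) (\<lambda>i. P i c)) \<le> 1"
  using contraction_row_le_1[OF contraction_compose[OF contraction_transpose[OF u] P] l] .

lemma contraction_transpose_mult_frobenius:
  assumes u: "contraction m N u"
  shows "(\<Sum>l<N. dot k (\<lambda>c. dot m (\<lambda>i. u i l) (\<lambda>i. P i c)) (\<lambda>c. dot m (\<lambda>i. u i l) (\<lambda>i. P i c)))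
    \<le> (\<Sum>i<m. dot k (P i) (P i))"
  using contraction_frobenius_compose[OF contraction_transpose[OF u], of P k] by (simp add: dot_def[of k] power2_eq_square)

text \<open>Ky Fan's inequality with a correction for the size of \<open>P\<close> and \<open>Q\<close>. Expanding \<open>X\<close> into rank one terms
  weights \<open>s l\<close> by an inner product \<open>\<langle>P\<^sup>T u\<^sub>l, Q\<^sup>T v\<^sub>l\<rangle>\<close>; the mean of the two squared lengths
  dominates it, is at most 1, and sums to at most the mean of the squared Frobenius norms.\<close>

lemma trace_pairing_le_svd:
  assumes X: "\<And>i j. i < m \<Longrightarrow> j < n \<Longrightarrow> X i j = (\<Sum>l<N. s l * (u i l * v j l))"
    and u: "contraction m N u" and v: "contraction n N v"
    and anti: "\<And>i j. i \<le> j \<Longrightarrow> j < N \<Longrightarrow> s j \<le> s i"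
    and pos: "\<And>i. i < N \<Longrightarrow> 0 \<le> s i"
    and P: "contraction m k P" and Q: "contraction n k Q" and t: "1 \<le> t" "t \<le> N"
  shows "trace_pairing m n k X P Q \<le> (\<Sum>l<t. s l) +
    s (t - 1) * (((\<Sum>i<m. dot k (P i) (P i)) + (\<Sum>j<n. dot k (Q j) (Q j))) / 2 - real t)"
proof -
  define a where "a l = (\<lambda>c. dot m (\<lambda>i. u i l) (\<lambda>i. P i c))" for l
  define b where "b l = (\<lambda>c. dot n (\<lambda>j. v j l) (\<lambda>j. Q j c))" for l
  define c where "c l = (dot k (a l) (a l) + dot k (b l) (b l)) / 2" for l
  have c01: "0 \<le> c l \<and> c l \<le> 1" if "l < N" for l
    using contraction_transpose_mult_row_le_1[OF u P that] contraction_transpose_mult_row_le_1[OF v Q that] 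
      dot_self_nonneg[of k "a l"] dot_self_nonneg[of k "b l"]
    unfolding c_def a_def b_def by simp
  have "trace_pairing m n k X P Q = (\<Sum>l<N. s l * dot k (a l) (b l))"
    unfolding a_def b_def by (rule trace_pairing_rank_one_expansion[OF X])
  also have "\<dots> \<le> (\<Sum>l<N. s l * c l)"
    using pos dot_le_mean unfolding c_def by (intro sum_mono mult_left_mono) auto
  also have "\<dots> \<le> (\<Sum>l<t. s l) + s (t - 1) * ((\<Sum>l<N. c l) - real t)"
    by (rule weighted_sum_le_top_sum[OF anti c01 t])
  also have "\<dots> \<le> (\<Sum>l<t. s l) + s (t - 1) *
      (((\<Sum>i<m. dot k (P i) (P i)) + (\<Sum>j<n. dot k (Q j) (Q j))) / 2 - real t)"
  proof -
    have "(\<Sum>l<N. c l) \<le> ((\<Sum>i<m. dot k (P i) (P i)) + (\<Sum>j<n. dot k (Q j) (Q j))) / 2"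
      using contraction_transpose_mult_frobenius[OF u, of k P] contraction_transpose_mult_frobenius[OF v, of k Q]
      unfolding c_def a_def b_def by (simp add: sum_divide_distrib[symmetric] sum.distrib)
    then show ?thesis using pos[of "t - 1"] t by (intro add_left_mono mult_left_mono) auto
  qed
  finally show ?thesis .
qed

text \<open>The symmetric version. The eigenvalues may be negative, so the weights must sum exactly to the
  squared Frobenius norm of \<open>P\<close>, which is why the rows of \<open>g\<close> have to be orthonormal.\<close>

lemma trace_pairing_le_spectral:
  assumes M: "\<And>i j. i < n \<Longrightarrow> j < n \<Longrightarrow> X i j = (\<Sum>l<n. a l * (g i l * g j l))"
    and g: "contraction n n g"
    and gc: "\<And>i j. i < n \<Longrightarrow> j < n \<Longrightarrow> dot n (g i) (g j) = (if i = j then 1 else 0)"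
    and anti: "\<And>i j. i \<le> j \<Longrightarrow> j < n \<Longrightarrow> a j \<le> a i"
    and P: "contraction n k P" and t: "1 \<le> t" "t \<le> n"
  shows "trace_pairing n n k X P P \<le> (\<Sum>l<t. a l) + a (t - 1) * ((\<Sum>i<n. dot k (P i) (P i)) - real t)"
proof -
  define b where "b l = (\<lambda>c. dot n (\<lambda>i. g i l) (\<lambda>i. P i c))" for l
  have "trace_pairing n n k X P P = (\<Sum>l<n. a l * dot k (b l) (b l))"
    unfolding b_def by (rule trace_pairing_rank_one_expansion[OF M])
  also have "\<dots> \<le> (\<Sum>l<t. a l) + a (t - 1) * ((\<Sum>l<n. dot k (b l) (b l)) - real t)"
    using contraction_transpose_mult_row_le_1[OF g P] dot_self_nonneg
    by (intro weighted_sum_le_top_sum[OF anti _ t]) (auto simp: b_def)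
  also have "(\<Sum>l<n. dot k (b l) (b l)) = (\<Sum>i<n. dot k (P i) (P i))"
  proof -
    have "(\<Sum>l<n. dot k (b l) (b l)) = trace_pairing n n k (\<lambda>i j. \<Sum>l<n. 1 * (g i l * g j l)) P P"
      unfolding b_def
      by (subst trace_pairing_rank_one_expansion[where s = "\<lambda>_. 1" and u = g and v = g and N = n, OF refl]) simp
    also have "\<dots> = (\<Sum>i<n. \<Sum>j<n. if i = j then dot k (P i) (P i) else 0)"
      unfolding trace_pairing_def using gc by (intro sum.cong refl) (auto simp: dot_def)
    finally show ?thesis by simp
  qed
  finally show ?thesis .
qed

section \<open>Orthogonal diagonalization of real symmetric matrices\<close>

lemma orthonormal_matD:
  assumes "orthonormal_mat n Q"
  shows "Q \<in> carrier_mat n n" "Q\<^sup>T * Q = 1\<^sub>m n" "Q * Q\<^sup>T = 1\<^sub>m n"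
  using assms by (auto simp: orthonormal_mat_def)

lemma orthonormal_mat_mult:
  assumes P: "orthonormal_mat n P" and Q: "orthonormal_mat n Q"
  shows "orthonormal_mat n (P * Q)"
proof -
  note p[simp] = orthonormal_matD(1)[OF P] and q[simp] = orthonormal_matD(1)[OF Q]
  note [simp] = orthonormal_matD(2,3)[OF P] orthonormal_matD(2,3)[OF Q]
  have t: "(P * Q)\<^sup>T = Q\<^sup>T * P\<^sup>T" by (rule transpose_mult[OF p q])
  have "(P * Q)\<^sup>T * (P * Q) = Q\<^sup>T * (P\<^sup>T * P) * Q" unfolding t
    by (smt (verit) assoc_mult_mat mult_carrier_mat p q transpose_carrier_mat)
  moreover have "(P * Q) * (P * Q)\<^sup>T = P * (Q * Q\<^sup>T) * P\<^sup>T" unfolding t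
    by (smt (verit) assoc_mult_mat mult_carrier_mat p q transpose_carrier_mat)
  moreover have "P\<^sup>T * (1\<^sub>m n) = P\<^sup>T" "P * (1\<^sub>m n) = P" "Q\<^sup>T * 1\<^sub>m n = Q\<^sup>T"
    by (simp_all add: right_mult_one_mat[of _ n n])
  ultimately show ?thesis unfolding orthonormal_mat_def using mult_carrier_mat[OF p q] by simp
qed

text \<open>The Householder reflection that exchanges \<open>v\<close> and the first unit vector.\<close>

lemma exists_orthonormal_mat_with_first_col:
  assumes v: "v \<in> carrier_vec n" and v1: "v \<bullet> v = (1::real)" and n: "0 < n"
  obtains H where "orthonormal_mat n H" "col H 0 = v"
proof (cases "v = unit_vec n 0")
  case True
  have "orthonormal_mat n (1\<^sub>m n)" by (simp add: orthonormal_mat_def)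
  moreover have "col (1\<^sub>m n) 0 = v" using True n by simp
  ultimately show ?thesis by (rule that)
next
  case False
  define u where "u i = v $ i - (if i = 0 then 1 else 0)" for i
  define s where "s = (\<Sum>i<n. u i * u i)"
  have sv: "(\<Sum>i<n. v $ i * v $ i) = 1"
    using v1 v by (simp add: scalar_prod_def atLeast0LessThan)
  have "s = (\<Sum>i<n. v $ i * v $ i - 2 * (if i = 0 then v $ i else 0) + (if i = 0 then 1 else 0))"
    unfolding s_def u_def by (intro sum.cong refl) (auto simp: algebra_simps)
  also have "\<dots> = 1 - 2 * v $ 0 + 1"
    using n sv by (simp add: sum.distrib sum_subtractf sum_distrib_left[symmetric])
  finally have s: "s = 2 * (1 - v $ 0)" by simp
  have "s \<noteq> 0"
  proof
    assume "s = 0"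
    then have "\<forall>i<n. u i = 0" unfolding s_def by (simp add: sum_nonneg_eq_0_iff)
    then have "v = unit_vec n 0" using v by (intro eq_vecI) (auto simp: u_def split: if_splits)
    with False show False by simp
  qed
  \<comment> \<open>\<open>u = v - e\<^sub>0\<close> and \<open>s = \<bar>u\<bar>\<^sup>2\<close>, so this is the reflection in the hyperplane orthogonal to \<open>u\<close>.\<close>
  define H where "H = mat n n (\<lambda>(i, j). (if i = j then 1 else 0) - 2 / s * (u i * u j))"
  have H: "H \<in> carrier_mat n n" by (simp add: H_def)
  have Ht: "H\<^sup>T = H" by (rule eq_matI) (auto simp: H_def mult.commute)
  have HH: "H * H = 1\<^sub>m n"
  proof (rule eq_matI)
    fix i j assume "i < dim_row (1\<^sub>m n :: real mat)" "j < dim_col (1\<^sub>m n :: real mat)"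
    then have ij: "i < n" "j < n" by auto
    have "(H * H) $$ (i, j) =
      (\<Sum>l<n. ((if i = l then 1 else 0) - 2 / s * (u i * u l)) * ((if l = j then 1 else 0) - 2 / s * (u l * u j)))"
      using ij by (simp add: H_def scalar_prod_def atLeast0LessThan)
    also have "\<dots> = (\<Sum>l<n. (if l = i then (if i = j then 1 else 0) else 0) - (if l = i then 2 / s * (u i * u j) else 0)
       - (if l = j then 2 / s * (u i * u j) else 0) + (2 / s) * (2 / s) * (u i * u j) * (u l * u l))"
      by (intro sum.cong refl) (auto simp: algebra_simps)
    also have "\<dots> = (if i = j then 1 else 0) - 2 / s * (u i * u j) - 2 / s * (u i * u j) 
        + (2 / s) * (2 / s) * (u i * u j) * s"
      unfolding s_def using ij by (simp add: sum.distrib sum_subtractf sum_distrib_left)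
    also have "\<dots> = 1\<^sub>m n $$ (i, j)" using ij \<open>s \<noteq> 0\<close> by simp
    finally show "(H * H) $$ (i, j) = 1\<^sub>m n $$ (i, j)" .
  qed (auto simp: H_def)
  have "col H 0 = v"
  proof (rule eq_vecI)
    fix i assume "i < dim_vec v"
    then have i: "i < n" using v by simp
    have u0: "2 / s * u 0 = - 1"
      using \<open>s \<noteq> 0\<close> s by (simp add: u_def field_simps)
    have "col H 0 $ i = (if i = 0 then 1 else 0) - u i * (2 / s * u 0)"
      using i n by (simp add: H_def mult_ac)
    also have "\<dots> = v $ i" unfolding u0 by (simp add: u_def)
    finally show "col H 0 $ i = v $ i" .
  qed (use v H in auto)
  moreover have "orthonormal_mat n H" using H Ht HH by (simp add: orthonormal_mat_def)
  ultimately show ?thesis using that by blast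
qed

text \<open>The usual argument: for an eigenvector \<open>w\<close>, the number \<open>w\<^sup>* A w = z \<bar>w\<bar>\<^sup>2\<close> is its own conjugate.\<close>

lemma symmetric_complex_root_real:
  fixes A :: "real mat"
  assumes A: "A \<in> carrier_mat n n" and sym: "A\<^sup>T = A"
    and z: "poly (map_poly complex_of_real (char_poly A)) z = 0"
  shows "z \<in> \<real>"
proof -
  let ?A = "map_mat complex_of_real A"
  have Ac: "?A \<in> carrier_mat n n" using A by simp
  have "char_poly ?A = map_poly complex_of_real (char_poly A)" by (rule of_real_hom.char_poly_hom[OF A])
  with z have "poly (char_poly ?A) z = 0" by simp
  then have "eigenvalue ?A z" using eigenvalue_root_char_poly[OF Ac] by simp
  then obtain w where w: "w \<in> carrier_vec n" "w \<noteq> 0\<^sub>v n" and ev: "?A *\<^sub>v w = z \<cdot>\<^sub>v w"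
    using Ac unfolding eigenvalue_def eigenvector_def by auto
  have row: "(\<Sum>j<n. complex_of_real (A $$ (i, j)) * w $ j) = z * w $ i" if "i < n" for i
  proof -
    have "(?A *\<^sub>v w) $ i = z * w $ i" using ev that w by simp
    then show ?thesis using that A w by (simp add: scalar_prod_def atLeast0LessThan)
  qed
  have symm: "A $$ (i, j) = A $$ (j, i)" if "i < n" "j < n" for i j
    using arg_cong[OF sym, of "\<lambda>M. M $$ (j, i)"] that A by simp
  let ?q = "\<Sum>i<n. \<Sum>j<n. cnj (w $ i) * (complex_of_real (A $$ (i, j)) * w $ j)"
  let ?N = "\<Sum>i<n. cnj (w $ i) * w $ i"
  have q: "?q = z * ?N"
    by (simp add: sum_distrib_left[symmetric] row) (simp add: sum_distrib_left mult_ac)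
  have "cnj ?q = (\<Sum>i<n. \<Sum>j<n. cnj (w $ j) * (complex_of_real (A $$ (i, j)) * w $ i))"
    by (simp add: mult_ac)
  also have "\<dots> = (\<Sum>i<n. \<Sum>j<n. cnj (w $ i) * (complex_of_real (A $$ (j, i)) * w $ j))"
    by (rule sum.swap)
  also have "\<dots> = ?q" by (intro sum.cong refl) (simp add: symm)
  finally have "cnj ?q = ?q" .
  moreover have N: "?N = complex_of_real (\<Sum>i<n. (cmod (w $ i))\<^sup>2)"
    by (simp add: mult.commute complex_norm_square[symmetric])
  ultimately have eq: "cnj z * ?N = z * ?N" unfolding q by (simp add: N del: of_real_sum)
  have "?N \<noteq> 0"
  proof
    assume "?N = 0"
    then have "(\<Sum>i<n. (cmod (w $ i))\<^sup>2) = 0" unfolding N by (simp del: of_real_sum)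
    then have "\<forall>i<n. w $ i = 0" by (simp add: sum_nonneg_eq_0_iff)
    then have "w = 0\<^sub>v n" using w by (intro eq_vecI) auto
    with w show False by simp
  qed
  with eq have "cnj z = z" by simp
  then show ?thesis by (simp add: Reals_cnj_iff)
qed

lemma poly_splits_if_complex_roots_real:
  fixes p :: "real poly"
  assumes "monic p" "\<And>z. poly (map_poly complex_of_real p) z = 0 \<Longrightarrow> z \<in> \<real>"
  shows "\<exists>es. p = (\<Prod>e\<leftarrow>es. [:- e, 1:])"
  using assms
proof (induction "degree p" arbitrary: p)
  case 0
  then have "p = 1" using monic_degree_0[OF 0(2)] by simp
  then show ?case by (intro exI[of _ "[]"]) simp
next
  case (Suc d)
  have "degree (map_poly complex_of_real p) = degree p" by simp
  then have "\<not> constant (poly (map_poly complex_of_real p))"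
    using Suc.hyps(2) by (simp add: constant_degree)
  then obtain z where z: "poly (map_poly complex_of_real p) z = 0"
    using fundamental_theorem_of_algebra by blast
  then obtain e where e: "z = complex_of_real e" using Suc.prems(2) by (auto elim: Reals_cases)
  have "poly p e = 0"
    using z unfolding e of_real_hom.poly_map_poly by (simp only: of_real_eq_0_iff)
  then obtain q where q: "p = [:- e, 1:] * q" unfolding poly_eq_0_iff_dvd by (rule dvdE)
  have q0: "q \<noteq> 0"
  proof
    assume "q = 0"
    then show False using Suc.hyps(2) q by simp
  qed
  have "degree p = degree [:- e, 1:] + degree q"
    unfolding q by (rule degree_mult_eq) (simp, rule q0)
  then have "degree q = d" using Suc.hyps(2) by simp
  moreover have "monic q" using Suc.prems(1) unfolding q lead_coeff_mult by simp
  moreover have "z \<in> \<real>" if "poly (map_poly complex_of_real q) z = 0" for z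
  proof (rule Suc.prems(2))
    interpret h: map_poly_comm_ring_hom complex_of_real by unfold_locales auto
    show "poly (map_poly complex_of_real p) z = 0" unfolding q h.hom_mult using that by simp
  qed
  ultimately obtain es where "q = (\<Prod>e\<leftarrow>es. [:- e, 1:])" using Suc.hyps(1) by blast
  then show ?case unfolding q by (intro exI[of _ "e # es"]) simp
qed

definition diag_of_list :: "real list \<Rightarrow> real mat" where
  "diag_of_list es = mat (length es) (length es) (\<lambda>(i, j). if i = j then es ! i else 0)"

text \<open>The eigenvalues appear in the prescribed order \<open>es\<close>, because the induction splits off
  the first factor of the characteristic polynomial: in an orthonormal basis that starts with an
  eigenvector for it, symmetry makes the matrix block diagonal.\<close>

lemma orthogonal_diagonalization:
  fixes A :: "real mat"
  assumes "A \<in> carrier_mat n n" and "A\<^sup>T = A" and "char_poly A = (\<Prod>e\<leftarrow>es. [:- e, 1:])"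
  shows "\<exists>Q. orthonormal_mat n Q \<and> Q\<^sup>T * A * Q = diag_of_list es"
  using assms
proof (induction es arbitrary: n A)
  case Nil
  then have "n = 0" using degree_monic_char_poly[OF Nil(1)] by simp
  then show ?case using Nil
    by (intro exI[of _ "1\<^sub>m 0"]) (auto simp: orthonormal_mat_def diag_of_list_def intro!: eq_matI)
next
  case (Cons e es)
  note A = Cons.prems(1) and sym = Cons.prems(2)
  have cp: "char_poly A = [:- e, 1:] * (\<Prod>e\<leftarrow>es. [:- e, 1:])" using Cons.prems(3) by simp
  have "eigenvalue A e" unfolding eigenvalue_root_char_poly[OF A] cp by simp
  then obtain w where w: "w \<in> carrier_vec n" "w \<noteq> 0\<^sub>v n" and ev: "A *\<^sub>v w = e \<cdot>\<^sub>v w"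
    using A unfolding eigenvalue_def eigenvector_def by auto
  have ww: "w \<bullet> w > 0" 
  proof -
    have "w \<bullet> w \<noteq> 0"
    proof
      assume "w \<bullet> w = 0"
      then have "\<forall>i<n. w $ i = 0" using w
        by (simp add: scalar_prod_def sum_nonneg_eq_0_iff)
      then have "w = 0\<^sub>v n" using w by (intro eq_vecI) auto
      with w show False by simp
    qed
    moreover have "w \<bullet> w \<ge> 0" by (simp add: scalar_prod_def sum_nonneg)
    ultimately show ?thesis by simp
  qed
  have n: "0 < n" using w by (cases n) auto
  define v where "v = (1 / sqrt (w \<bullet> w)) \<cdot>\<^sub>v w"
  have v: "v \<in> carrier_vec n" using w by (simp add: v_def)
  have v1: "v \<bullet> v = 1" using w ww by (simp add: v_def)
  have Av: "A *\<^sub>v v = e \<cdot>\<^sub>v v"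
    unfolding v_def using A w ev by (simp add: mult_mat_vec smult_smult_assoc mult.commute)
  obtain H where H: "orthonormal_mat n H" and H0: "col H 0 = v"
    using exists_orthonormal_mat_with_first_col[OF v v1 n] .
  note Hc = orthonormal_matD(1)[OF H] and HtH = orthonormal_matD(2)[OF H] and HHt = orthonormal_matD(3)[OF H]
  have Htc: "H\<^sup>T \<in> carrier_mat n n" using Hc by simp
  define B where "B = H\<^sup>T * A * H"
  have Bc: "B \<in> carrier_mat n n" using Hc A by (simp add: B_def)
  have Bsym: "B\<^sup>T = B"
  proof -
    have "B\<^sup>T = H\<^sup>T * (H\<^sup>T * A)\<^sup>T" unfolding B_def
      by (rule transpose_mult[OF mult_carrier_mat[OF Htc A] Hc])
    also have "(H\<^sup>T * A)\<^sup>T = A\<^sup>T * H" using transpose_mult[OF Htc A] by simp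
    finally show ?thesis unfolding sym B_def using assoc_mult_mat[OF Htc A Hc] by simp
  qed
  have B0: "B $$ (i, 0) = (if i = 0 then e else 0)" if i: "i < n" for i
  proof -
    have "col B 0 = H\<^sup>T * A *\<^sub>v v" 
      unfolding B_def H0[symmetric] using Hc A n by (intro col_mult2) auto
    also have "\<dots> = H\<^sup>T *\<^sub>v (A *\<^sub>v v)" using Htc A v by (rule assoc_mult_mat_vec)
    also have "\<dots> = e \<cdot>\<^sub>v (H\<^sup>T *\<^sub>v v)" unfolding Av using Htc v by (rule mult_mat_vec)
    also have "H\<^sup>T *\<^sub>v v = col (H\<^sup>T * H) 0"
      unfolding H0[symmetric] using Hc n by (intro col_mult2[symmetric]) auto
    finally have "col B 0 = e \<cdot>\<^sub>v unit_vec n 0" unfolding HtH using n by simp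
    then have "col B 0 $ i = (e \<cdot>\<^sub>v unit_vec n 0) $ i" by simp
    then show ?thesis using i n Bc by (simp split: if_splits)
  qed
  have symB: "B $$ (i, j) = B $$ (j, i)" if "i < n" "j < n" for i j
    using arg_cong[OF Bsym, of "\<lambda>M. M $$ (j, i)"] that Bc by simp
  obtain n' where n': "n = 1 + n'" using n by (metis Suc_pred' plus_1_eq_Suc)
  define C where "C = mat n' n' (\<lambda>(i, j). B $$ (Suc i, Suc j))"
  define E where "E = mat 1 1 (\<lambda>_. e)"
  have Cc: "C \<in> carrier_mat n' n'" and Ec: "E \<in> carrier_mat 1 1" by (auto simp: C_def E_def)
  have B4: "B = four_block_mat E (0\<^sub>m 1 n') (0\<^sub>m n' 1) C"
  proof (rule eq_matI)
    fix i j assume "i < dim_row (four_block_mat E (0\<^sub>m 1 n') (0\<^sub>m n' 1) C)"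
      "j < dim_col (four_block_mat E (0\<^sub>m 1 n') (0\<^sub>m n' 1) C)"
    then have ij: "i < n" "j < n" by (auto simp: n' C_def E_def)
    then show "B $$ (i, j) = four_block_mat E (0\<^sub>m 1 n') (0\<^sub>m n' 1) C $$ (i, j)"
      using B0[of i] B0[of j] symB[of i j] by (auto simp: C_def E_def n')
  qed (use Bc in \<open>auto simp: n' C_def E_def\<close>)
  have "similar_mat B A"
    unfolding similar_mat_def similar_mat_wit_def
    by (rule exI[of _ "H\<^sup>T"], rule exI[of _ H]) (use Hc A Bc HtH HHt in \<open>auto simp: B_def Let_def\<close>)
  then have "char_poly A = char_poly B" by (simp add: char_poly_similar)
  also have "\<dots> = [:- e, 1:] * char_poly C"
    unfolding B4 using char_poly_four_block_zeros_col[OF Ec zero_carrier_mat Cc]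
    by (simp add: E_def char_poly_defs det_def)
  finally have "[:- e, 1:] * char_poly C = [:- e, 1:] * (\<Prod>e\<leftarrow>es. [:- e, 1:])"
    using cp by (rule subst)
  moreover have "[:- e, 1:] \<noteq> 0" by simp
  ultimately have "char_poly C = (\<Prod>e\<leftarrow>es. [:- e, 1:])"
    using mult_left_cancel by blast
  moreover have "C\<^sup>T = C" by (rule eq_matI) (auto simp: C_def symB n')
  ultimately obtain R where R: "orthonormal_mat n' R" and RC: "R\<^sup>T * C * R = diag_of_list es"
    using Cons.IH[OF Cc] by blast
  note Rc = orthonormal_matD(1)[OF R] 
  have es: "length es = n'" using arg_cong[OF RC, of dim_row] Rc by (simp add: diag_of_list_def)
  let ?z = "0\<^sub>m 1 n'" and ?z' = "0\<^sub>m n' 1"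
  define K where "K = four_block_mat (1\<^sub>m 1) ?z ?z' R"
  have Kc: "K \<in> carrier_mat n n" unfolding K_def n' using Rc by auto
  have Kt: "K\<^sup>T = four_block_mat (1\<^sub>m 1) ?z ?z' (R\<^sup>T)"
    unfolding K_def by (subst transpose_four_block_mat[OF _ _ _ Rc]) auto
  have one: "1\<^sub>m n = four_block_mat (1\<^sub>m 1) ?z ?z' (1\<^sub>m n')" unfolding n' by (rule four_block_one_mat[symmetric])
  have K: "orthonormal_mat n K"
  proof -
    have "K\<^sup>T * K = 1\<^sub>m n" unfolding Kt one
      unfolding K_def by (subst mult_four_block_mat[of _ 1 1 _ n' _ n' _ _ 1 _ n']) 
        (use Rc orthonormal_matD[OF R] in auto)
    moreover have "K * K\<^sup>T = 1\<^sub>m n" unfolding Kt one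
      unfolding K_def by (subst mult_four_block_mat[of _ 1 1 _ n' _ n' _ _ 1 _ n']) 
        (use Rc orthonormal_matD[OF R] in auto)
    ultimately show ?thesis using Kc by (simp add: orthonormal_mat_def)
  qed
  have KBK: "K\<^sup>T * B * K = diag_of_list (e # es)"
  proof -
    have "K\<^sup>T * B = four_block_mat E ?z ?z' (R\<^sup>T * C)"
      unfolding Kt B4 by (subst mult_four_block_mat[of _ 1 1 _ n' _ n' _ _ 1 _ n']) (use Rc Ec Cc in auto)
    then have "K\<^sup>T * B * K = four_block_mat E ?z ?z' (R\<^sup>T * C * R)"
      unfolding K_def
      by (simp only:) (subst mult_four_block_mat[of _ 1 1 _ n' _ n' _ _ 1 _ n'], use Rc Ec Cc in auto)
    also have "\<dots> = diag_of_list (e # es)" unfolding RC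
      by (rule eq_matI) (auto simp: diag_of_list_def E_def es nth_Cons')
    finally show ?thesis .
  qed
  have "(H * K)\<^sup>T * A * (H * K) = diag_of_list (e # es)"
  proof -
    have "(H * K)\<^sup>T * A * (H * K) = K\<^sup>T * H\<^sup>T * A * (H * K)" using transpose_mult[OF Hc Kc] by simp
    also have "\<dots> = K\<^sup>T * B * K" unfolding B_def
      by (smt (verit) assoc_mult_mat mult_carrier_mat Hc Kc A transpose_carrier_mat)
    finally show ?thesis using KBK by simp
  qed
  with orthonormal_mat_mult[OF H K] show ?case by blast
qed

text \<open>The length is part of the statement since \<open>eigenvalue_desc\<close> is a list entry and
  has a meaning only within the list.\<close>

lemma char_poly_eq_prod_eigenvalue_desc:
  fixes A :: "real mat"
  assumes A: "A \<in> carrier_mat n n" and sym: "A\<^sup>T = A"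
  shows "char_poly A = (\<Prod>e\<leftarrow>map (\<lambda>l. eigenvalue_desc A (Suc l)) [0..<n]. [:- e, 1:])"
    and "length (sorted_list_of_multiset (proots (char_poly A))) = n"
proof -
  define es where "es = rev (sorted_list_of_multiset (proots (char_poly A)))"
  obtain fs where fs: "char_poly A = (\<Prod>e\<leftarrow>fs. [:- e, 1:])"
    using poly_splits_if_complex_roots_real[of "char_poly A"] degree_monic_char_poly[OF A]
      symmetric_complex_root_real[OF A sym] by blast
  have "proots (\<Prod>e\<leftarrow>fs. [:- e, 1:]) = mset fs"
  proof (induction fs)
    case (Cons f fs)
    have "[:- f, 1:] * (\<Prod>e\<leftarrow>fs. [:- e, 1:]) \<noteq> 0"
      by (simp only: mult_eq_0_iff prod_list_zero_iff) auto
    then show ?case using Cons by (simp add: proots_mult del: mult_pCons_left)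
  qed simp
  then have ms: "mset es = mset fs" unfolding es_def fs by simp
  have "prod_mset (mset (map (\<lambda>e. [:- e, 1:]) es)) = prod_mset (mset (map (\<lambda>e. [:- e, 1:]) fs))"
    by (simp only: mset_map ms)
  then have cp: "char_poly A = (\<Prod>e\<leftarrow>es. [:- e, 1:])"
    by (simp only: fs prod_mset_prod_list)
  obtain Q where Q: "orthonormal_mat n Q" and D: "Q\<^sup>T * A * Q = diag_of_list es"
    using orthogonal_diagonalization[OF A sym cp] by blast
  have len: "length es = n"
    using arg_cong[OF D, of dim_col] orthonormal_matD(1)[OF Q] by (simp add: diag_of_list_def)
  then show "length (sorted_list_of_multiset (proots (char_poly A))) = n" by (simp add: es_def)
  have "map (\<lambda>l. eigenvalue_desc A (Suc l)) [0..<n] = es"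
    using map_nth[of es] len by (simp add: eigenvalue_desc_def es_def)
  then show "char_poly A = (\<Prod>e\<leftarrow>map (\<lambda>l. eigenvalue_desc A (Suc l)) [0..<n]. [:- e, 1:])"
    using cp by (simp only:)
qed

lemma eigenvalue_desc_antimono:
  fixes A :: "real mat"
  assumes A: "A \<in> carrier_mat n n" and sym: "A\<^sup>T = A" and "i \<le> j" "j < n"
  shows "eigenvalue_desc A (Suc j) \<le> eigenvalue_desc A (Suc i)"
proof -
  let ?es = "rev (sorted_list_of_multiset (proots (char_poly A)))"
  have "?es ! j \<le> ?es ! i"
    using assms(3,4) char_poly_eq_prod_eigenvalue_desc(2)[OF A sym]
    by (intro sorted_rev_nth_mono) simp_all
  then show ?thesis by (simp add: eigenvalue_desc_def)
qed

lemma index_mult_transpose: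
  assumes "X \<in> carrier_mat m n" "Y \<in> carrier_mat k n" "i < m" "j < k"
  shows "(X * Y\<^sup>T) $$ (i, j) = (\<Sum>l<n. X $$ (i, l) * Y $$ (j, l))"
  using assms by (simp add: scalar_prod_def atLeast0LessThan)

text \<open>The columns of \<open>g\<close> are eigenvectors, ordered by nonincreasing eigenvalues.\<close>

lemma spectral_expansion:
  fixes A :: "real mat"
  assumes A: "A \<in> carrier_mat n n" and sym: "A\<^sup>T = A"
  shows "\<exists>g. orthonormal_mat n g \<and> (\<forall>i<n. \<forall>j<n.
    A $$ (i, j) = (\<Sum>l<n. eigenvalue_desc A (Suc l) * (g $$ (i, l) * g $$ (j, l))))"
proof -
  define es where "es = map (\<lambda>l. eigenvalue_desc A (Suc l)) [0..<n]"
  have len: "length es = n" and ed: "\<And>i. i < n \<Longrightarrow> eigenvalue_desc A (Suc i) = es ! i"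
    by (simp_all add: es_def)
  have cp: "char_poly A = (\<Prod>e\<leftarrow>es. [:- e, 1:])"
    unfolding es_def by (rule char_poly_eq_prod_eigenvalue_desc(1)[OF A sym])
  obtain Q where Q: "orthonormal_mat n Q" and QAQ: "Q\<^sup>T * A * Q = diag_of_list es"
    using orthogonal_diagonalization[OF A sym cp] by blast
  note Qc = orthonormal_matD(1)[OF Q] 
  have D: "diag_of_list es \<in> carrier_mat n n" using len by (simp add: diag_of_list_def)
  have "Q * diag_of_list es * Q\<^sup>T = (Q * Q\<^sup>T) * A * (Q * Q\<^sup>T)" unfolding QAQ[symmetric]
    by (smt (verit) assoc_mult_mat mult_carrier_mat Qc A transpose_carrier_mat)
  also have "\<dots> = A" unfolding orthonormal_matD(3)[OF Q] using A by simp
  finally have Aeq: "A = Q * diag_of_list es * Q\<^sup>T" by simp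
  have "A $$ (i, j) = (\<Sum>l<n. eigenvalue_desc A (Suc l) * (Q $$ (i, l) * Q $$ (j, l)))"
    if ij: "i < n" "j < n" for i j
  proof -
    have QD: "(Q * diag_of_list es) $$ (i, l) = Q $$ (i, l) * es ! l" if l: "l < n" for l
    proof -
      have "(Q * diag_of_list es) $$ (i, l) = (\<Sum>r<n. Q $$ (i, r) * (if r = l then es ! r else 0))"
        using Qc len ij l by (simp add: scalar_prod_def atLeast0LessThan diag_of_list_def)
      also have "\<dots> = (\<Sum>r<n. if r = l then Q $$ (i, l) * es ! l else 0)"
        by (intro sum.cong) auto
      finally show ?thesis using l by simp
    qed
    have "A $$ (i, j) = (Q * diag_of_list es * Q\<^sup>T) $$ (i, j)" using Aeq by simp
    also have "\<dots> = (\<Sum>l<n. (Q * diag_of_list es) $$ (i, l) * Q $$ (j, l))"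
      by (rule index_mult_transpose[OF mult_carrier_mat[OF Qc D] Qc ij])
    also have "\<dots> = (\<Sum>l<n. eigenvalue_desc A (Suc l) * (Q $$ (i, l) * Q $$ (j, l)))"
      by (intro sum.cong refl) (simp add: QD ed mult_ac)
    finally show ?thesis .
  qed
  with Q show ?thesis by blast
qed

section \<open>Ky Fan's maximum principle\<close>

lemma orthonormal_mat_dot:
  assumes "orthonormal_mat n g"
  shows "l < n \<Longrightarrow> l' < n \<Longrightarrow> dot n (\<lambda>i. g $$ (i, l)) (\<lambda>i. g $$ (i, l')) = (if l = l' then 1 else 0)"
    and "l < n \<Longrightarrow> l' < n \<Longrightarrow> dot n (\<lambda>i. g $$ (l, i)) (\<lambda>i. g $$ (l', i)) = (if l = l' then 1 else 0)"
proof -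
  note g = orthonormal_matD[OF assms]
  show "dot n (\<lambda>i. g $$ (i, l)) (\<lambda>i. g $$ (i, l')) = (if l = l' then 1 else 0)" if "l < n" "l' < n"
    using arg_cong[OF g(2), of "\<lambda>M. M $$ (l, l')"] g(1) that
    by (simp add: dot_def scalar_prod_def atLeast0LessThan)
  show "dot n (\<lambda>i. g $$ (l, i)) (\<lambda>i. g $$ (l', i)) = (if l = l' then 1 else 0)" if "l < n" "l' < n"
    using arg_cong[OF g(3), of "\<lambda>M. M $$ (l, l')"] g(1) that
    by (simp add: dot_def scalar_prod_def atLeast0LessThan)
qed

lemma contraction_orthonormal_mat:
  assumes "orthonormal_mat n g" "k \<le> n"
  shows "contraction n k (\<lambda>i l. g $$ (i, l))"
proof (rule contractionI_orthogonal_columns)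
  show "dot n (\<lambda>i. g $$ (i, l)) (\<lambda>i. g $$ (i, l')) = 0" if "l < k" "l' < k" "l \<noteq> l'" for l l'
    using orthonormal_mat_dot(1)[OF assms(1), of l l'] that assms(2) by simp
  show "dot n (\<lambda>i. g $$ (i, l)) (\<lambda>i. g $$ (i, l)) \<le> 1" if "l < k" for l
    using orthonormal_mat_dot(1)[OF assms(1), of l l] that assms(2) by simp
qed

lemma gram_symmetric: "(X\<^sup>T * X)\<^sup>T = X\<^sup>T * (X :: real mat)"
proof -
  have "X \<in> carrier_mat (dim_row X) (dim_col X)" by (rule carrier_matI) (rule refl)+
  then have "(X\<^sup>T * X)\<^sup>T = X\<^sup>T * X\<^sup>T\<^sup>T"
    by (intro transpose_mult) (simp_all only: transpose_carrier_mat)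
  then show ?thesis by (simp only: transpose_transpose)
qed

text \<open>The left vectors \<open>u\<close> are orthonormal for nonzero singular values and zero otherwise, so that both
  factors are determined by a spectral decomposition of \<open>X\<^sup>T X\<close>, for any \<open>m\<close> and \<open>n\<close>.\<close>

definition thin_svd :: "nat \<Rightarrow> nat \<Rightarrow> real mat \<Rightarrow> (nat \<Rightarrow> nat \<Rightarrow> real) \<Rightarrow> (nat \<Rightarrow> nat \<Rightarrow> real) \<Rightarrow> bool" where
  "thin_svd m n X u v \<longleftrightarrow>
     (\<forall>i<m. \<forall>j<n. X $$ (i, j) = (\<Sum>l<n. singular_value X (Suc l) * (u i l * v j l))) \<and>
     (\<forall>l<n. \<forall>l'<n. dot n (\<lambda>i. v i l) (\<lambda>i. v i l') = (if l = l' then 1 else 0)) \<and>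
     (\<forall>l<n. \<forall>l'<n. dot m (\<lambda>i. u i l) (\<lambda>i. u i l') =
        (if l = l' \<and> singular_value X (Suc l) \<noteq> 0 then 1 else 0)) \<and>
     (\<forall>l<n. 0 \<le> singular_value X (Suc l))"

lemmas thin_svdD =
  thin_svd_def[THEN iffD1, THEN conjunct1, rule_format]
  thin_svd_def[THEN iffD1, THEN conjunct2, THEN conjunct1, rule_format]
  thin_svd_def[THEN iffD1, THEN conjunct2, THEN conjunct2, THEN conjunct1, rule_format]
  thin_svd_def[THEN iffD1, THEN conjunct2, THEN conjunct2, THEN conjunct2, rule_format]

lemma thin_svd_contraction:
  assumes svd: "thin_svd m n X u v" and k: "k \<le> n"
  shows "contraction m k u" and "contraction n k v"
proof -
  show "contraction m k u"
  proof (rule contractionI_orthogonal_columns)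
    show "dot m (\<lambda>i. u i l) (\<lambda>i. u i l') = 0" if "l < k" "l' < k" "l \<noteq> l'" for l l'
      using thin_svdD(3)[OF svd, of l l'] that k by simp
    show "dot m (\<lambda>i. u i l) (\<lambda>i. u i l) \<le> 1" if "l < k" for l
      using thin_svdD(3)[OF svd, of l l] that k by simp
  qed
  show "contraction n k v"
  proof (rule contractionI_orthogonal_columns)
    show "dot n (\<lambda>i. v i l) (\<lambda>i. v i l') = 0" if "l < k" "l' < k" "l \<noteq> l'" for l l'
      using thin_svdD(2)[OF svd, of l l'] that k by simp
    show "dot n (\<lambda>i. v i l) (\<lambda>i. v i l) \<le> 1" if "l < k" for l
      using thin_svdD(2)[OF svd, of l l] that k by simp
  qed
qed

lemma singular_value_antimono:
  assumes X: "X \<in> carrier_mat m n" and "i \<le> j" "j < n"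
  shows "singular_value X (Suc j) \<le> singular_value X (Suc i)"
proof -
  have "X\<^sup>T * X \<in> carrier_mat n n" using X by simp
  then have "eigenvalue_desc (X\<^sup>T * X) (Suc j) \<le> eigenvalue_desc (X\<^sup>T * X) (Suc i)"
    using gram_symmetric assms(2,3) by (rule eigenvalue_desc_antimono)
  then show ?thesis unfolding singular_value_def by (rule real_sqrt_le_mono)
qed

text \<open>The right vectors \<open>v\<close> are an eigenbasis of \<open>X\<^sup>T X\<close>. The vectors \<open>X v\<^sub>l\<close> are then orthogonal with
  squared lengths equal to the eigenvalues, and normalizing them gives \<open>u\<close>.\<close>

lemma thin_svd_exists:
  fixes X :: "real mat"
  assumes X: "X \<in> carrier_mat m n"
  shows "\<exists>u v. thin_svd m n X u v"
proof -
  let ?G = "X\<^sup>T * X"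
  have Gc: "?G \<in> carrier_mat n n" using X by simp
  have G: "?G $$ (j, j') = dot m (\<lambda>i. X $$ (i, j)) (\<lambda>i. X $$ (i, j'))" if "j < n" "j' < n" for j j'
    using that X by (simp add: dot_def scalar_prod_def atLeast0LessThan)
  obtain g where gG: "orthonormal_mat n g \<and> (\<forall>i<n. \<forall>j<n.
      ?G $$ (i, j) = (\<Sum>l<n. eigenvalue_desc ?G (Suc l) * (g $$ (i, l) * g $$ (j, l))))"
    using spectral_expansion[OF Gc gram_symmetric] ..
  note g = gG[THEN conjunct1] and Gg = gG[THEN conjunct2, rule_format]
  define lam where "lam l = eigenvalue_desc ?G (Suc l)" for l
  define s where "s l = singular_value X (Suc l)" for l
  have s_lam: "s l = sqrt (lam l)" for l by (simp add: s_def lam_def singular_value_def)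
  define v where "v j l = g $$ (j, l)" for j l
  define y where "y i l = dot n (\<lambda>j. X $$ (i, j)) (\<lambda>j. v j l)" for i l
  \<comment> \<open>Division by zero yields the zero vector where the singular value is 0.\<close>
  define u where "u i l = y i l / s l" for i l
  have vv: "dot n (\<lambda>i. v i l) (\<lambda>i. v i l') = (if l = l' then 1 else 0)" if "l < n" "l' < n" for l l'
    using orthonormal_mat_dot(1)[OF g that] by (simp add: v_def)
  have yy: "dot m (\<lambda>i. y i l) (\<lambda>i. y i l') = (if l = l' then lam l else 0)" if l: "l < n" "l' < n" for l l'
  proof -
    have Gv: "dot m (\<lambda>i. X $$ (i, j)) (\<lambda>i. y i l') = lam l' * v j l'" if j: "j < n" for j
    proof -
      have "dot m (\<lambda>i. X $$ (i, j)) (\<lambda>i. y i l') = (\<Sum>j'<n. ?G $$ (j, j') * v j' l')"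
        unfolding y_def by (subst dot_transpose) (simp add: dot_def[of n] G j dot_commute mult.commute)
      also have "\<dots> = (\<Sum>j'<n. \<Sum>r<n. lam r * (v j r * v j' r) * v j' l')"
        by (simp add: Gg j lam_def v_def sum_distrib_right del: index_mult_mat)
      also have "\<dots> = (\<Sum>r<n. lam r * v j r * dot n (\<lambda>i. v i r) (\<lambda>i. v i l'))"
        by (subst sum.swap) (simp add: dot_def sum_distrib_left mult_ac)
      also have "\<dots> = (\<Sum>r<n. if r = l' then lam l' * v j l' else 0)"
        using l by (intro sum.cong refl) (auto simp: vv)
      finally show ?thesis using l by simp
    qed
    have "dot m (\<lambda>i. y i l) (\<lambda>i. y i l') = dot m (\<lambda>i. y i l') (\<lambda>i. dot n (\<lambda>j. X $$ (i, j)) (\<lambda>j. v j l))"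
      by (simp add: y_def dot_commute)
    also have "\<dots> = dot n (\<lambda>j. dot m (\<lambda>i. X $$ (i, j)) (\<lambda>i. y i l')) (\<lambda>j. v j l)"
      by (rule dot_transpose)
    also have "\<dots> = lam l' * dot n (\<lambda>j. v j l') (\<lambda>j. v j l)"
      by (simp add: dot_def[of n] Gv sum_distrib_left mult.assoc)
    finally show ?thesis using l by (simp add: vv)
  qed
  have lam0: "0 \<le> lam l" if "l < n" for l
    using yy[OF that that] dot_self_nonneg[of m "\<lambda>i. y i l"] by simp
  have s0: "0 \<le> s l" if "l < n" for l using lam0[OF that] by (simp add: s_lam)
  have ss: "s l * s l = lam l" if "l < n" for l using lam0[OF that] by (simp add: s_lam)
  have uu: "dot m (\<lambda>i. u i l) (\<lambda>i. u i l') = (if l = l' \<and> s l \<noteq> 0 then 1 else 0)" if "l < n" "l' < n" for l l'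
  proof -
    have "dot m (\<lambda>i. u i l) (\<lambda>i. u i l') = dot m (\<lambda>i. y i l) (\<lambda>i. y i l') / (s l * s l')"
      by (simp add: u_def dot_def sum_divide_distrib)
    then show ?thesis using yy[OF that] ss[OF that(1)] by auto
  qed
  have su: "s l * u i l = y i l" if "l < n" "i < m" for l i
  proof (cases "s l = 0")
    case True
    then have "(\<Sum>i<m. y i l * y i l) = 0" using yy[of l l] ss[of l] that by (simp add: dot_def)
    then have "y i l = 0" using that by (simp add: sum_nonneg_eq_0_iff)
    then show ?thesis using True by simp
  qed (simp add: u_def)
  have exp: "X $$ (i, j) = (\<Sum>l<n. s l * (u i l * v j l))" if ij: "i < m" "j < n" for i j
  proof -
    have "(\<Sum>l<n. s l * (u i l * v j l)) = (\<Sum>l<n. y i l * v j l)"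
      using ij by (intro sum.cong refl) (simp add: su mult.assoc[symmetric])
    also have "\<dots> = (\<Sum>l<n. \<Sum>j'<n. X $$ (i, j') * (v j' l * v j l))"
      by (simp add: y_def dot_def sum_distrib_left sum_distrib_right mult_ac)
    also have "\<dots> = (\<Sum>j'<n. X $$ (i, j') * dot n (\<lambda>l. v j' l) (\<lambda>l. v j l))"
      by (subst sum.swap) (simp add: dot_def sum_distrib_left)
    also have "\<dots> = (\<Sum>j'<n. if j' = j then X $$ (i, j) else 0)"
      using ij orthonormal_mat_dot(2)[OF g] by (intro sum.cong refl) (auto simp: v_def)
    finally show ?thesis using ij by simp
  qed
  show ?thesis
    unfolding thin_svd_def s_def[symmetric]
    by (rule exI[of _ u], rule exI[of _ v]) (intro conjI allI impI exp vv uu s0; assumption)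
qed

lemma trace_pairing_le_singular_values:
  assumes X: "X \<in> carrier_mat m n" and P: "contraction m k P" and Q: "contraction n k Q" and t: "1 \<le> t" "t \<le> n"
  shows "trace_pairing m n k (\<lambda>i j. X $$ (i, j)) P Q \<le> (\<Sum>l<t. singular_value X (Suc l)) +
    singular_value X t * (((\<Sum>i<m. dot k (P i) (P i)) + (\<Sum>j<n. dot k (Q j) (Q j))) / 2 - real t)"
proof -
  obtain u v where svd: "thin_svd m n X u v" using thin_svd_exists[OF X] by blast
  note uv = thin_svdD[OF svd]
  have u: "contraction m n u" and v: "contraction n n v" using thin_svd_contraction[OF svd order_refl] .
  have t1: "Suc (t - 1) = t" using t by simp
  show ?thesis
    using trace_pairing_le_svd[where X = "\<lambda>i j. X $$ (i, j)" and s = "\<lambda>l. singular_value X (Suc l)"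
        and u = u and v = v, OF uv(1) u v singular_value_antimono[OF X] uv(4) P Q t]
    by (simp only: t1)
qed

lemma singular_value_nonneg:
  assumes X: "X \<in> carrier_mat m n" and i: "i < n"
  shows "0 \<le> singular_value X (Suc i)"
  using thin_svd_exists[OF X] thin_svdD(4)[OF _ i] by blast

lemma ky_fan_norm_eq: "ky_fan_norm k X = (\<Sum>l<k. singular_value X (Suc l))"
  unfolding ky_fan_norm_def by (rule sum.reindex_bij_witness[of _ Suc "\<lambda>i. i - 1"]) auto

lemma trace_pairing_le_ky_fan_norm:
  assumes X: "X \<in> carrier_mat m n" and k: "1 \<le> k" "k \<le> n" and P: "contraction m k P" and Q: "contraction n k Q"
  shows "trace_pairing m n k (\<lambda>i j. X $$ (i, j)) P Q \<le> ky_fan_norm k X"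
proof -
  have "0 \<le> singular_value X k" using singular_value_nonneg[OF X, of "k - 1"] k by simp
  moreover have "((\<Sum>i<m. dot k (P i) (P i)) + (\<Sum>j<n. dot k (Q j) (Q j))) / 2 - real k \<le> 0"
    using contraction_frobenius[OF P] contraction_frobenius[OF Q] by simp
  ultimately have "singular_value X k *
      (((\<Sum>i<m. dot k (P i) (P i)) + (\<Sum>j<n. dot k (Q j) (Q j))) / 2 - real k) \<le> 0"
    by (rule mult_nonneg_nonpos)
  then show ?thesis
    using trace_pairing_le_singular_values[OF X P Q k] unfolding ky_fan_norm_eq by linarith
qed

text \<open>The first \<open>k\<close> left and right singular vectors are optimal.\<close>

lemma ky_fan_norm_attained:
  assumes X: "X \<in> carrier_mat m n" and k: "k \<le> n"
  obtains P Q where "contraction m k P" "contraction n k Q" "trace_pairing m n k (\<lambda>i j. X $$ (i, j)) P Q = ky_fan_norm k X"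
proof -
  obtain u v where svd: "thin_svd m n X u v" using thin_svd_exists[OF X] by blast
  note uv = thin_svdD[OF svd]
  have u: "contraction m k u" and v: "contraction n k v" using thin_svd_contraction[OF svd k] .
  have "trace_pairing m n k (\<lambda>i j. X $$ (i, j)) u v = (\<Sum>l<n. singular_value X (Suc l) *
      dot k (\<lambda>c. dot m (\<lambda>i. u i l) (\<lambda>i. u i c)) (\<lambda>c. dot n (\<lambda>j. v j l) (\<lambda>j. v j c)))"
    by (rule trace_pairing_rank_one_expansion[OF uv(1)])
  also have "\<dots> = (\<Sum>l<n. if l < k then singular_value X (Suc l) else 0)"
  proof (intro sum.cong refl, goal_cases)
    case (1 l)
    have "dot k (\<lambda>c. dot m (\<lambda>i. u i l) (\<lambda>i. u i c)) (\<lambda>c. dot n (\<lambda>j. v j l) (\<lambda>j. v j c)) =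
      (\<Sum>c<k. if c = l then (if singular_value X (Suc l) \<noteq> 0 then 1 else 0) else 0)"
      unfolding dot_def[of k]
    proof (intro sum.cong refl, goal_cases)
      case (1 c)
      then show ?case using uv(2)[of l c] uv(3)[of l c] \<open>l \<in> {..<n}\<close> k by simp
    qed
    then show ?case by (simp add: sum.delta)
  qed
  also have "\<dots> = (\<Sum>l\<in>{..<n} \<inter> {l. l < k}. singular_value X (Suc l))"
    by (simp only: sum.inter_restrict finite_lessThan mem_Collect_eq)
  also have "{..<n} \<inter> {l. l < k} = {..<k}" using k by auto
  finally show ?thesis using that[OF u v] by (simp only: ky_fan_norm_eq)
qed

text \<open>The Gram matrix is replaced by a similar one.\<close>

lemma ky_fan_norm_orthogonal_invariant:
  assumes X: "X \<in> carrier_mat m n" and U: "orthonormal_mat m U" and V: "orthonormal_mat n V"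
  shows "ky_fan_norm k (U\<^sup>T * X * V) = ky_fan_norm k X"
proof -
  note Uc = orthonormal_matD(1)[OF U] and Vc = orthonormal_matD(1)[OF V]
  have "(U\<^sup>T * X * V)\<^sup>T = V\<^sup>T * (U\<^sup>T * X)\<^sup>T" 
    by (rule transpose_mult[of _ m n]) (use X Uc Vc in auto)
  also have "(U\<^sup>T * X)\<^sup>T = X\<^sup>T * U"
    using transpose_mult[of "U\<^sup>T" m m X n] X Uc by simp
  finally have "(U\<^sup>T * X * V)\<^sup>T * (U\<^sup>T * X * V) = V\<^sup>T * (X\<^sup>T * U) * (U\<^sup>T * X * V)" by simp
  also have "\<dots> = V\<^sup>T * (X\<^sup>T * (U * U\<^sup>T) * X) * V"
    using X Uc Vc by (simp add: assoc_mult_mat[of _ n n _ m _ n] assoc_mult_mat[of _ n m _ m _ n]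
      assoc_mult_mat[of _ n m _ n _ n] assoc_mult_mat[of _ m m _ n _ n] assoc_mult_mat[of _ m m _ m _ n] 
      assoc_mult_mat[of _ n n _ m _ m] assoc_mult_mat[of _ n n _ n _ n] assoc_mult_mat[of _ n m _ m _ m])
  also have "\<dots> = V\<^sup>T * (X\<^sup>T * X) * V"
    unfolding orthonormal_matD(3)[OF U] using X by (simp add: right_mult_one_mat[of _ n m])
  finally have eq: "(U\<^sup>T * X * V)\<^sup>T * (U\<^sup>T * X * V) = V\<^sup>T * (X\<^sup>T * X) * V" .
  have "similar_mat (V\<^sup>T * (X\<^sup>T * X) * V) (X\<^sup>T * X)"
    by (rule similar_matI[of _ _ "V\<^sup>T" V n]) (use X Vc orthonormal_matD[OF V] in auto)
  then have "char_poly (V\<^sup>T * (X\<^sup>T * X) * V) = char_poly (X\<^sup>T * X)" by (rule char_poly_similar)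
  then show ?thesis unfolding ky_fan_norm_def singular_value_def eigenvalue_desc_def eq by simp
qed

lemma trace_pairing_smult:
  "X \<in> carrier_mat m n \<Longrightarrow> trace_pairing m n k (\<lambda>i j. (a \<cdot>\<^sub>m X) $$ (i, j)) P Q = a * trace_pairing m n k (\<lambda>i j. X $$ (i, j)) P Q"
  by (auto simp: trace_pairing_def sum_distrib_left mult.assoc intro!: sum.cong)

lemma trace_pairing_add_smult:
  "X \<in> carrier_mat m n \<Longrightarrow> Y \<in> carrier_mat m n \<Longrightarrow> trace_pairing m n k (\<lambda>i j. (X + a \<cdot>\<^sub>m Y) $$ (i, j)) P Q =
    trace_pairing m n k (\<lambda>i j. X $$ (i, j)) P Q + a * trace_pairing m n k (\<lambda>i j. Y $$ (i, j)) P Q"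
  by (simp add: trace_pairing_def sum_distrib_left mult.assoc distrib_right sum.distrib)

text \<open>Both inequalities follow from the maximum principle, since the pairing is linear in the matrix.\<close>

lemma ky_fan_norm_smult_nonneg:
  assumes X: "X \<in> carrier_mat m n" and k: "1 \<le> k" "k \<le> n" and a: "0 \<le> a"
  shows "ky_fan_norm k (a \<cdot>\<^sub>m X) = a * ky_fan_norm k X"
proof (rule antisym)
  have aX: "a \<cdot>\<^sub>m X \<in> carrier_mat m n" using X by simp
  obtain P Q where "contraction m k P" "contraction n k Q" "trace_pairing m n k (\<lambda>i j. (a \<cdot>\<^sub>m X) $$ (i, j)) P Q = ky_fan_norm k (a \<cdot>\<^sub>m X)"
    using ky_fan_norm_attained[OF aX k(2)] .
  then show "ky_fan_norm k (a \<cdot>\<^sub>m X) \<le> a * ky_fan_norm k X"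
    using trace_pairing_le_ky_fan_norm[OF X k, of P Q] a trace_pairing_smult[OF X, of k a P Q] mult_left_mono by metis
  obtain P Q where "contraction m k P" "contraction n k Q" "trace_pairing m n k (\<lambda>i j. X $$ (i, j)) P Q = ky_fan_norm k X"
    using ky_fan_norm_attained[OF X k(2)] .
  then show "a * ky_fan_norm k X \<le> ky_fan_norm k (a \<cdot>\<^sub>m X)"
    using trace_pairing_le_ky_fan_norm[OF aX k, of P Q] trace_pairing_smult[OF X, of k a P Q] by metis
qed

section \<open>Pairs that are nearly optimal for a diagonal matrix\<close>

lemma trace_pairing_cong:
  assumes "\<And>i j. i < m \<Longrightarrow> j < n \<Longrightarrow> X i j = Y i j"
  shows "trace_pairing m n k X P Q = trace_pairing m n k Y P Q"
  unfolding trace_pairing_def by (intro sum.cong refl) (simp add: assms)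

text \<open>A list \<open>s\<close> of \<open>n\<close> singular values, numbered from 0, of which those with index
  \<open>r, \<dots>, q - 1\<close> equal the level \<open>h = s (k - 1)\<close>; the earlier ones are larger and the later ones smaller, by at
  least the gap \<open>g\<close>. Choosing
  \<open>g \<le> 1\<close>, and \<open>g \<le> h\<close> for a positive level, lets a single constant compare all the losses below.\<close>

locale singular_block =
  fixes m n r q k :: nat and s :: "nat \<Rightarrow> real" and h g :: real
  assumes nm: "n \<le> m" and rk: "r < k" and kq: "k \<le> q" and qn: "q \<le> n"
    and h0: "0 \<le> h" and g0: "0 < g" and g1: "g \<le> 1" and gh: "h \<noteq> 0 \<Longrightarrow> g \<le> h"
    and top: "\<And>i. i < r \<Longrightarrow> h + g \<le> s i"
    and mid: "\<And>i. r \<le> i \<Longrightarrow> i < q \<Longrightarrow> s i = h"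
    and bot: "\<And>i. q \<le> i \<Longrightarrow> i < n \<Longrightarrow> s i \<le> h - g"
    and s0: "\<And>i. i < n \<Longrightarrow> 0 \<le> s i"

locale contracted_singular_block = singular_block +
  fixes P Q :: "nat \<Rightarrow> nat \<Rightarrow> real"
  assumes P: "contraction m k P" and Q: "contraction n k Q"
begin

text \<open>By polarization \<open>\<langle>p\<^sub>i, q\<^sub>i\<rangle> = mass i - defect i\<close> with \<open>defect i = \<bar>p\<^sub>i - q\<^sub>i\<bar>\<^sup>2 / 2\<close>.\<close>

definition mass where "mass i = (dot k (P i) (P i) + dot k (Q i) (Q i)) / 2"
definition defect where "defect i = mass i - dot k (P i) (Q i)"
text \<open>The four ways of falling short of the maximum at the diagonal matrix: the first block is not filled,
  the last one is not empty, the total mass is less than \<open>k\<close>, and the rows of \<open>P\<close> and \<open>Q\<close> differ. The third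
  and the fourth count with weights, since they cost nothing where the level or the singular value is zero.\<close>

definition slack where
  "slack = (\<Sum>i<r. 1 - mass i) + (\<Sum>i=q..<n. mass i) + h * (real k - (\<Sum>i<n. mass i)) + (\<Sum>i<n. s i * defect i)"

lemma mass_bounds: "i < n \<Longrightarrow> 0 \<le> mass i \<and> mass i \<le> 1"
  using contraction_row_le_1[OF P, of i] contraction_row_le_1[OF Q, of i] nm
    dot_self_nonneg[of k "P i"] dot_self_nonneg[of k "Q i"] by (simp add: mass_def)

lemma defect_eq: "defect i = dot k (\<lambda>l. P i l - Q i l) (\<lambda>l. P i l - Q i l) / 2"
  by (simp add: defect_def mass_def dot_diff_self field_simps)

lemma defect_nonneg: "0 \<le> defect i"
  by (simp add: defect_eq dot_self_nonneg)

lemma sum_row_norms_le: "(\<Sum>i<n. dot k (P i) (P i)) \<le> (\<Sum>i<m. dot k (P i) (P i))"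
  using nm dot_self_nonneg by (intro sum_mono2) auto

lemma sum_mass_le: "(\<Sum>i<n. mass i) \<le> real k"
proof -
  have "(\<Sum>i<n. mass i) = ((\<Sum>i<n. dot k (P i) (P i)) + (\<Sum>i<n. dot k (Q i) (Q i))) / 2"
    by (simp add: mass_def sum_divide_distrib[symmetric] sum.distrib)
  then show ?thesis
    using sum_row_norms_le contraction_frobenius[OF P] contraction_frobenius[OF Q] by simp
qed

lemma top_part_nonneg: "0 \<le> (\<Sum>i<r. 1 - mass i)"
  using mass_bounds rk kq qn by (intro sum_nonneg) auto
lemma bot_part_nonneg: "0 \<le> (\<Sum>i=q..<n. mass i)"
  using mass_bounds by (intro sum_nonneg) auto
lemma trace_part_nonneg: "0 \<le> h * (real k - (\<Sum>i<n. mass i))"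
  using h0 sum_mass_le by simp
lemma diff_part_nonneg: "0 \<le> (\<Sum>i<n. s i * defect i)"
  using s0 defect_nonneg by (intro sum_nonneg) auto

lemmas parts_nonneg = top_part_nonneg bot_part_nonneg trace_part_nonneg diff_part_nonneg

lemma slack_nonneg: "0 \<le> slack"
  using parts_nonneg unfolding slack_def by linarith

lemma sum_over_blocks: "(\<Sum>i<n. f i) = (\<Sum>i<r. f i) + (\<Sum>i=r..<q. f i) + (\<Sum>i=q..<n. f i)" for f :: "nat \<Rightarrow> real"
proof -
  have "{..<n} = {..<r} \<union> {r..<q} \<union> {q..<n}" using rk kq qn by auto
  then have "sum f {..<n} = sum f ({..<r} \<union> {r..<q} \<union> {q..<n})" by simp
  also have "\<dots> = sum f ({..<r} \<union> {r..<q}) + sum f {q..<n}"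
    using rk kq by (intro sum.union_disjoint) auto
  also have "sum f ({..<r} \<union> {r..<q}) = sum f {..<r} + sum f {r..<q}"
    by (rule sum.union_disjoint) auto
  finally show ?thesis .
qed

text \<open>With \<open>\<Sum>\<^sub>i s\<^sub>i mass\<^sub>i = \<Sum>\<^sub>i (s\<^sub>i - h) mass\<^sub>i + h \<Sum>\<^sub>i mass\<^sub>i\<close> the middle block disappears from the first sum. In the other two
  blocks the coefficient is at least \<open>g\<close> in absolute value and has the sign that turns
  missing or superfluous mass into a loss.\<close>

lemma diagonal_loss:
  "(\<Sum>i<n. s i * dot k (P i) (Q i)) \<le> (\<Sum>i<k. s i) - g * slack"
proof -
  have "(\<Sum>i<n. s i * dot k (P i) (Q i)) = (\<Sum>i<n. s i * mass i) - (\<Sum>i<n. s i * defect i)"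
    by (simp add: defect_def right_diff_distrib sum_subtractf)
  also have "(\<Sum>i<n. s i * mass i) = (\<Sum>i<n. (s i - h) * mass i) + h * (\<Sum>i<n. mass i)"
    by (simp add: left_diff_distrib sum_subtractf sum_distrib_left)
  also have "(\<Sum>i<n. (s i - h) * mass i) = (\<Sum>i<r. (s i - h) * mass i) + (\<Sum>i=q..<n. (s i - h) * mass i)"
    using mid by (subst sum_over_blocks) simp
  also have "(\<Sum>i<r. (s i - h) * mass i) \<le> (\<Sum>i<r. (s i - h) - g * (1 - mass i))"
  proof (rule sum_mono, goal_cases)
    case (1 i)
    have "0 \<le> (s i - h - g) * (1 - mass i)"
      using 1 top[of i] mass_bounds[of i] rk kq qn by simp
    then show ?case by (simp add: algebra_simps)
  qed
  also have "(\<Sum>i<r. (s i - h) - g * (1 - mass i)) = (\<Sum>i<r. s i - h) - g * (\<Sum>i<r. 1 - mass i)"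
    by (subst sum_subtractf) (simp only: sum_distrib_left)
  also have "(\<Sum>i=q..<n. (s i - h) * mass i) \<le> (\<Sum>i=q..<n. - g * mass i)"
    using bot mass_bounds by (intro sum_mono mult_right_mono) (auto simp: algebra_simps)
  finally have *: "(\<Sum>i<n. s i * dot k (P i) (Q i)) \<le> (\<Sum>i<r. s i - h) - g * (\<Sum>i<r. 1 - mass i)
      - g * (\<Sum>i=q..<n. mass i) + h * (\<Sum>i<n. mass i) - (\<Sum>i<n. s i * defect i)"
    by (simp add: sum_negf sum_distrib_left[symmetric])
  have "(\<Sum>i<k. s i - h) = (\<Sum>i<r. s i - h)"
    using rk kq mid by (intro sum.mono_neutral_right) auto
  then have k: "(\<Sum>i<k. s i) = (\<Sum>i<r. s i - h) + h * real k"
    by (simp add: sum_subtractf mult.commute)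
  have 1: "g * (h * (real k - (\<Sum>i<n. mass i))) \<le> 1 * (h * (real k - (\<Sum>i<n. mass i)))"
    using g1 trace_part_nonneg by (rule mult_right_mono)
  have 2: "g * (\<Sum>i<n. s i * defect i) \<le> 1 * (\<Sum>i<n. s i * defect i)"
    using g1 diff_part_nonneg by (rule mult_right_mono)
  have 3: "g * slack = g * (\<Sum>i<r. 1 - mass i) + g * (\<Sum>i=q..<n. mass i)
      + g * (h * (real k - (\<Sum>i<n. mass i))) + g * (\<Sum>i<n. s i * defect i)"
    unfolding slack_def by (simp only: distrib_left)
  have 4: "h * (real k - (\<Sum>i<n. mass i)) = h * real k - h * (\<Sum>i<n. mass i)" by (rule right_diff_distrib)
  show ?thesis using * k 1 2 3 4 by linarith
qed

text \<open>The slack rescaled so that it directly bounds the squared quantities in the following lemmas.\<close>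

definition deviation where "deviation = 2 * slack / g"

lemma slack_le_deviation: "2 * slack \<le> deviation"
  using g0 g1 slack_nonneg mult_left_mono[of g 1 slack] by (simp add: deviation_def pos_le_divide_eq mult.commute)

lemma deviation_nonneg: "0 \<le> deviation"
  using slack_le_deviation slack_nonneg by linarith

lemma g_slack: "g * slack = g\<^sup>2 / 2 * deviation"
  using g0 by (simp add: deviation_def power2_eq_square)

lemma top_sum_le: "(\<Sum>i<r. 1 - mass i) \<le> slack"
  using parts_nonneg unfolding slack_def by linarith

lemma bot_sum_le: "(\<Sum>i=q..<n. mass i) \<le> slack"
  using parts_nonneg unfolding slack_def by linarith

lemma top_le: "i < r \<Longrightarrow> 1 - mass i \<le> slack"
  using member_le_sum[of i "{..<r}" "\<lambda>i. 1 - mass i"] mass_bounds rk kq qn top_sum_le by force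

lemma top_rows: "i < r \<Longrightarrow> 1 - dot k (P i) (P i) \<le> deviation \<and> 1 - dot k (Q i) (Q i) \<le> deviation"
  using top_le[of i] slack_le_deviation contraction_row_le_1[OF P, of i] contraction_row_le_1[OF Q, of i] nm rk kq qn
  by (auto simp: mass_def field_simps)

lemma bot_rows: "q \<le> i \<Longrightarrow> i < n \<Longrightarrow> dot k (P i) (P i) \<le> deviation \<and> dot k (Q i) (Q i) \<le> deviation"
  using member_le_sum[of i "{q..<n}" mass] mass_bounds bot_sum_le slack_le_deviation
    dot_self_nonneg[of k "P i"] dot_self_nonneg[of k "Q i"] by (force simp: mass_def)

lemma diff_le:
  assumes "i < n" "g \<le> s i"
  shows "2 * defect i \<le> deviation"
proof -
  have "g * defect i \<le> s i * defect i" using assms(2) defect_nonneg by (rule mult_right_mono)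
  also have "\<dots> \<le> (\<Sum>i<n. s i * defect i)"
    using assms(1) s0 defect_nonneg by (intro member_le_sum) auto
  also have "\<dots> \<le> slack" using parts_nonneg unfolding slack_def by linarith
  finally show ?thesis using g0 by (simp add: deviation_def pos_le_divide_eq mult_ac)
qed

text \<open>Replacing \<open>p\<^sub>i\<close> by \<open>q\<^sub>i\<close> in an inner product is harmless if the singular value is bounded away from zero.\<close>

lemma abs_diff_dot_le:
  assumes "i < n" "g \<le> s i" "dot k z z \<le> 1"
  shows "\<bar>dot k (\<lambda>l. P i l - Q i l) z\<bar> \<le> sqrt deviation"
  using diff_le[OF assms(1,2)] assms(3) by (intro abs_dot_le) (simp_all add: defect_eq)

lemma top_gap: "i < r \<Longrightarrow> g \<le> s i"
  using top[of i] h0 by simp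

text \<open>The diagonal entries are \<open>mass i - defect i\<close>. Off the diagonal, exchange \<open>p\<^sub>i\<close> for \<open>q\<^sub>i\<close> (or \<open>q\<^sub>j\<close> for \<open>p\<^sub>j\<close>), where the index exchanged
  is the one in the first block; then \<open>contraction_offdiag\<close> applies to two rows of
  the same matrix.\<close>

lemma top_entries:
  assumes "i < m" "j < n" "i < r \<or> j < r"
  shows "\<bar>dot k (P i) (Q j) - (if i = j then 1 else 0)\<bar> \<le> deviation + 2 * sqrt deviation"
proof -
  have y0: "0 \<le> deviation" "0 \<le> sqrt deviation" using deviation_nonneg by simp_all
  show ?thesis
  proof (cases "i = j")
    case True
    then have i: "i < r" using assms by auto
    then have "defect i \<le> deviation / 2" "1 - mass i \<le> deviation / 2" "mass i \<le> 1"
      using diff_le[of i] top_gap top_le[of i] slack_le_deviation mass_bounds[of i] rk kq qn by auto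
    moreover have "dot k (P i) (Q i) = mass i - defect i" by (simp add: defect_def)
    ultimately have "\<bar>dot k (P i) (Q i) - 1\<bar> \<le> deviation" using defect_nonneg[of i] by (simp add: abs_le_iff)
    then have "\<bar>dot k (P i) (Q i) - 1\<bar> \<le> deviation + 2 * sqrt deviation" using y0 by linarith
    then show ?thesis using True by simp
  next
    case False
    have "\<bar>dot k (P i) (Q j)\<bar> \<le> 2 * sqrt deviation"
    proof (cases "i < r")
      case True
      have i: "i < n" using True rk kq qn by simp
      have "(dot k (Q i) (Q j))\<^sup>2 \<le> deviation"
        using contraction_offdiag[OF Q i assms(2) False] top_rows[OF True] by simp
      then have "\<bar>dot k (Q i) (Q j)\<bar> \<le> sqrt deviation" using real_le_rsqrt[of "\<bar>dot k (Q i) (Q j)\<bar>" deviation] by simp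
      moreover have "\<bar>dot k (\<lambda>l. P i l - Q i l) (Q j)\<bar> \<le> sqrt deviation"
        using abs_diff_dot_le[OF i top_gap[OF True] contraction_row_le_1[OF Q assms(2)]] .
      ultimately show ?thesis by (simp add: dot_diff_left)
    next
      case nr: False
      then have j: "j < r" using assms by simp
      have "(dot k (P j) (P i))\<^sup>2 \<le> deviation"
        using contraction_offdiag[OF P _ assms(1), of j] False assms(2) nm top_rows[OF j] by simp
      then have "\<bar>dot k (P j) (P i)\<bar> \<le> sqrt deviation" using real_le_rsqrt[of "\<bar>dot k (P j) (P i)\<bar>" deviation] by simp
      moreover have "\<bar>dot k (\<lambda>l. P j l - Q j l) (P i)\<bar> \<le> sqrt deviation"
        using abs_diff_dot_le[OF assms(2) top_gap[OF j] contraction_row_le_1[OF P assms(1)]] .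
      ultimately show ?thesis by (simp add: dot_diff_left dot_commute[of k "P i"])
    qed
    then show ?thesis using False y0 by simp
  qed
qed

text \<open>At a positive level, missing mass costs \<open>h \<ge> g\<close> per unit.\<close>

lemma trace_gap:
  assumes "h \<noteq> 0"
  shows "2 * (real k - (\<Sum>i<n. mass i)) \<le> deviation"
proof -
  have "g * (real k - (\<Sum>i<n. mass i)) \<le> h * (real k - (\<Sum>i<n. mass i))"
    using gh[OF assms] sum_mass_le by (intro mult_right_mono) auto
  also have "\<dots> \<le> slack" using parts_nonneg unfolding slack_def by linarith
  finally have "2 * (g * (real k - (\<Sum>i<n. mass i))) \<le> 2 * slack" by simp
  then show ?thesis using g0 unfolding deviation_def by (subst pos_le_divide_eq) (simp_all only: mult_ac)
qed

lemma sum_P_ge: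
  assumes "h \<noteq> 0"
  shows "real k - deviation \<le> (\<Sum>i<n. dot k (P i) (P i))"
proof -
  have "(\<Sum>i<n. mass i) = ((\<Sum>i<n. dot k (P i) (P i)) + (\<Sum>i<n. dot k (Q i) (Q i))) / 2"
    by (simp add: mass_def sum_divide_distrib[symmetric] sum.distrib)
  then show ?thesis using trace_gap[OF assms] contraction_frobenius[OF Q] by simp
qed

text \<open>For \<open>i \<ge> n\<close> there is no singular value to pay for such a row; it is short since the rows
  with smaller index already use up almost all of the squared Frobenius norm, which is
  at most \<open>k\<close>.\<close>

lemma extra_rows:
  assumes "h \<noteq> 0" "q \<le> i" "i < m"
  shows "dot k (P i) (P i) \<le> deviation"
proof (cases "i < n")
  case True then show ?thesis using bot_rows assms by simp
next
  case False
  have "(\<Sum>i\<in>insert i {..<n}. dot k (P i) (P i)) \<le> (\<Sum>i<m. dot k (P i) (P i))"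
    using nm assms False dot_self_nonneg by (intro sum_mono2) auto
  then show ?thesis using False sum_P_ge[OF assms(1)] contraction_frobenius[OF P] by simp
qed

text \<open>What the first block and the last one leave of the total \<open>k\<close>.\<close>

lemma mid_trace:
  assumes "h \<noteq> 0"
  shows "\<bar>(\<Sum>i=r..<q. dot k (P i) (P i)) - real (k - r)\<bar> \<le> 2 * deviation"
proof -
  let ?a = "\<lambda>i. dot k (P i) (P i)"
  have a1: "?a i \<le> 1" if "i < m" for i using contraction_row_le_1[OF P that] .
  have "(\<Sum>i<r. 1 - ?a i) \<le> (\<Sum>i<r. 2 * (1 - mass i))"
    using contraction_row_le_1[OF Q] rk kq qn by (intro sum_mono) (simp add: mass_def field_simps)
  then have 1: "real r - (\<Sum>i<r. ?a i) \<le> deviation"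
    using top_sum_le slack_le_deviation by (simp add: sum_subtractf sum_distrib_left[symmetric])
  have "(\<Sum>i<r. ?a i) \<le> (\<Sum>i<r. 1)" using a1 rk kq qn nm by (intro sum_mono) auto
  then have 2: "(\<Sum>i<r. ?a i) \<le> real r" by simp
  have "(\<Sum>i=q..<n. ?a i) \<le> (\<Sum>i=q..<n. 2 * mass i)"
    using dot_self_nonneg by (intro sum_mono) (simp add: mass_def)
  then have 3: "(\<Sum>i=q..<n. ?a i) \<le> deviation"
    using bot_sum_le slack_le_deviation by (simp add: sum_distrib_left[symmetric])
  have 4: "0 \<le> (\<Sum>i=q..<n. ?a i)" using dot_self_nonneg by (intro sum_nonneg) auto
  have 5: "(\<Sum>i<n. ?a i) \<le> real k" using sum_row_norms_le contraction_frobenius[OF P] by simp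
  have 6: "real k - deviation \<le> (\<Sum>i<n. ?a i)" by (rule sum_P_ge[OF assms])
  have 7: "real (k - r) = real k - real r" using rk by simp
  show ?thesis using 1 2 3 4 5 6 7 deviation_nonneg sum_over_blocks[of ?a] by (simp add: abs_le_iff)
qed

lemma mid_entries:
  assumes "h \<noteq> 0" "r \<le> j" "j < q" "i < m"
  shows "\<bar>dot k (P i) (Q j) - dot k (P i) (P j)\<bar> \<le> sqrt deviation"
proof -
  have "\<bar>dot k (\<lambda>l. P j l - Q j l) (P i)\<bar> \<le> sqrt deviation"
    using assms mid[of j] gh qn by (intro abs_diff_dot_le contraction_row_le_1[OF P]) auto
  then show ?thesis by (simp add: dot_diff_left dot_commute[of k "P i"])
qed

text \<open>In the middle block \<open>q\<^sub>j\<close> is replaced by \<open>p\<^sub>j\<close>, so that a quadratic form in the rows of \<open>P\<close> alone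
  remains, and only the symmetric part of the perturbation matters.\<close>

lemma positive_level_entries:
  assumes "h \<noteq> 0" "i < m" "j < n"
  shows "\<bar>dot k (P i) (Q j) - (if i < r \<or> j < r then (if i = j then 1 else 0)
     else if i < q \<and> j < q then dot k (P i) (P j) else 0)\<bar> \<le> 2 * (deviation + sqrt deviation)"
proof -
  note y0 = deviation_nonneg real_sqrt_ge_zero[OF deviation_nonneg]
  consider "i < r \<or> j < r" | "r \<le> i" "r \<le> j" "i < q" "j < q" | "r \<le> i" "r \<le> j" "q \<le> i" | "r \<le> i" "r \<le> j" "q \<le> j"
    by linarith
  then show ?thesis
  proof cases
    case 1 then show ?thesis using top_entries[OF assms(2,3)] y0 by (simp split: if_splits)
  next
    case 2 then show ?thesis using mid_entries[OF assms(1), of j i] assms y0 by simp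
  next
    case 3
    have "\<bar>dot k (P i) (Q j)\<bar> \<le> sqrt deviation"
      using extra_rows[OF assms(1) 3(3) assms(2)] contraction_row_le_1[OF Q assms(3)] by (rule abs_dot_le)
    then show ?thesis using 3 y0 by simp
  next
    case 4
    have "\<bar>dot k (Q j) (P i)\<bar> \<le> sqrt deviation"
      using bot_rows[of j] 4 assms contraction_row_le_1[OF P assms(2)] by (intro abs_dot_le) auto
    then show ?thesis using 4 y0 by (simp add: dot_commute)
  qed
qed

lemma trace_pairing_perturb:
  fixes B T :: "nat \<Rightarrow> nat \<Rightarrow> real"
  assumes "\<And>i j. i < m \<Longrightarrow> j < n \<Longrightarrow> \<bar>dot k (P i) (Q j) - T i j\<bar> \<le> e"
  shows "trace_pairing m n k B P Q \<le> (\<Sum>i<m. \<Sum>j<n. B i j * T i j) + (\<Sum>i<m. \<Sum>j<n. \<bar>B i j\<bar>) * e"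
proof -
  have "trace_pairing m n k B P Q \<le> (\<Sum>i<m. \<Sum>j<n. B i j * T i j + \<bar>B i j\<bar> * e)"
    unfolding trace_pairing_def
  proof (intro sum_mono, goal_cases)
    case (1 i j)
    have "B i j * (dot k (P i) (Q j) - T i j) \<le> \<bar>B i j\<bar> * \<bar>dot k (P i) (Q j) - T i j\<bar>"
      by (metis abs_ge_self abs_mult)
    also have "\<dots> \<le> \<bar>B i j\<bar> * e" using 1 assms by (intro mult_left_mono) auto
    finally show ?case by (simp add: algebra_simps)
  qed
  then show ?thesis by (simp add: sum.distrib sum_distrib_right)
qed

lemma sum_first_block_identity:
  fixes B R :: "nat \<Rightarrow> nat \<Rightarrow> real"
  shows "(\<Sum>i<m. \<Sum>j<n. B i j * (if i < r \<or> j < r then (if i = j then 1 else 0) else R i j)) =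
    (\<Sum>i<r. B i i) + (\<Sum>i<m - r. \<Sum>j<n - r. B (r + i) (r + j) * R (r + i) (r + j))"
proof -
  have m: "m = r + (m - r)" and n: "n = r + (n - r)" using nm rk kq qn by auto
  let ?f = "\<lambda>i j. B i j * (if i < r \<or> j < r then (if i = j then 1 else 0) else R i j)"
  have 1: "(\<Sum>j<n. ?f i j) = B i i" if "i < r" for i
  proof -
    have "(\<Sum>j<n. ?f i j) = (\<Sum>j<n. if i = j then B i i else 0)"
      using that by (intro sum.cong) auto
    then show ?thesis using that rk kq qn by simp
  qed
  have 2: "(\<Sum>j<n. ?f (r + i) j) = (\<Sum>j<n - r. B (r + i) (r + j) * R (r + i) (r + j))" for i
    by (subst n, subst sum_lessThan_add) simp
  have "(\<Sum>i<r. \<Sum>j<n. ?f i j) = (\<Sum>i<r. B i i)" by (intro sum.cong refl 1) simp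
  then show ?thesis by (subst (1) m, subst sum_lessThan_add) (simp only: 2)
qed

text \<open>The premise is a maximum principle for the quadratic form of the middle block of \<open>B\<close>. Its
  correction term is small by \<open>mid_trace\<close>.\<close>

lemma positive_level_bound:
  fixes B :: "nat \<Rightarrow> nat \<Rightarrow> real" and lam :: "nat \<Rightarrow> real"
  assumes h: "h \<noteq> 0"
    and spec: "\<And>R. contraction (q - r) k R \<Longrightarrow> trace_pairing (q - r) (q - r) k (\<lambda>i j. B (r + i) (r + j)) R R
      \<le> D + c * ((\<Sum>i<q - r. dot k (R i) (R i)) - real (k - r))"
  shows "trace_pairing m n k B P Q \<le> (\<Sum>i<r. B i i) + D +
     (2 * (\<Sum>i<m. \<Sum>j<n. \<bar>B i j\<bar>) + 2 * \<bar>c\<bar>) * (deviation + sqrt deviation)"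
proof -
  let ?R = "\<lambda>i j. if i < q \<and> j < q then dot k (P i) (P j) else 0"
  let ?S = "\<lambda>i. P (r + i)"
  have "trace_pairing m n k B P Q \<le> (\<Sum>i<m. \<Sum>j<n. B i j * (if i < r \<or> j < r then (if i = j then 1 else 0) else ?R i j))
     + (\<Sum>i<m. \<Sum>j<n. \<bar>B i j\<bar>) * (2 * (deviation + sqrt deviation))"
    by (rule trace_pairing_perturb, rule positive_level_entries[OF h])
  also have "(\<Sum>i<m. \<Sum>j<n. B i j * (if i < r \<or> j < r then (if i = j then 1 else 0) else ?R i j)) =
    (\<Sum>i<r. B i i) + (\<Sum>i<m - r. \<Sum>j<n - r. B (r + i) (r + j) * ?R (r + i) (r + j))"
    by (rule sum_first_block_identity)
  also have "(\<Sum>i<m - r. \<Sum>j<n - r. B (r + i) (r + j) * ?R (r + i) (r + j)) =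
      (\<Sum>i<q - r. \<Sum>j<q - r. B (r + i) (r + j) * ?R (r + i) (r + j))"
  proof -
    have "(\<Sum>j<n - r. B (r + i) (r + j) * ?R (r + i) (r + j)) = (\<Sum>j<q - r. B (r + i) (r + j) * ?R (r + i) (r + j))" for i
      using qn by (intro sum.mono_neutral_right) auto
    moreover have "(\<Sum>i<m - r. \<Sum>j<q - r. B (r + i) (r + j) * ?R (r + i) (r + j)) =
       (\<Sum>i<q - r. \<Sum>j<q - r. B (r + i) (r + j) * ?R (r + i) (r + j))"
      using qn nm by (intro sum.mono_neutral_right) (auto intro!: sum.neutral)
    ultimately show ?thesis by simp
  qed
  also have "\<dots> = trace_pairing (q - r) (q - r) k (\<lambda>i j. B (r + i) (r + j)) ?S ?S"
    unfolding trace_pairing_def using rk kq by (intro sum.cong refl) auto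
  also have "\<dots> \<le> D + c * ((\<Sum>i<q - r. dot k (?S i) (?S i)) - real (k - r))"
    using rk kq qn nm by (intro spec contraction_rows[OF P]) auto
  also have "(\<Sum>i<q - r. dot k (?S i) (?S i)) = (\<Sum>i=r..<q. dot k (P i) (P i))"
    by (rule sum.reindex_bij_witness[of _ "\<lambda>i. i - r" "\<lambda>i. r + i"]) auto
  also have "c * ((\<Sum>i=r..<q. dot k (P i) (P i)) - real (k - r)) \<le> 2 * \<bar>c\<bar> * (deviation + sqrt deviation)"
  proof -
    have "c * ((\<Sum>i=r..<q. dot k (P i) (P i)) - real (k - r)) 
       \<le> \<bar>c\<bar> * \<bar>(\<Sum>i=r..<q. dot k (P i) (P i)) - real (k - r)\<bar>"
      by (metis abs_ge_self abs_mult)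
    also have "\<dots> \<le> \<bar>c\<bar> * (2 * (deviation + sqrt deviation))"
    proof (rule mult_left_mono)
      have "2 * deviation \<le> 2 * (deviation + sqrt deviation)" using deviation_nonneg by simp
      then show "\<bar>(\<Sum>i=r..<q. dot k (P i) (P i)) - real (k - r)\<bar> \<le> 2 * (deviation + sqrt deviation)"
        using mid_trace[OF h] by (rule order_trans[rotated])
    qed simp
    finally show ?thesis by (simp only: mult_ac)
  qed
  finally show ?thesis by (simp add: algebra_simps)
qed

text \<open>The premise is a maximum principle for the trailing \<open>(m - r) \<times> (n - r)\<close> block of \<open>B\<close>. Since \<open>c \<ge> 0\<close>, only an
  upper bound for the size of the trailing rows is required. It follows from the first block being
  almost filled.\<close>

lemma zero_level_bound:
  fixes B :: "nat \<Rightarrow> nat \<Rightarrow> real"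
  assumes c: "0 \<le> c"
    and spec: "\<And>R S. contraction (m - r) k R \<Longrightarrow> contraction (n - r) k S \<Longrightarrow> trace_pairing (m - r) (n - r) k (\<lambda>i j. B (r + i) (r + j)) R S
      \<le> D + c * (((\<Sum>i<m - r. dot k (R i) (R i)) + (\<Sum>j<n - r. dot k (S j) (S j))) / 2 - real (k - r))"
  shows "trace_pairing m n k B P Q \<le> (\<Sum>i<r. B i i) + D +
     (2 * (\<Sum>i<m. \<Sum>j<n. \<bar>B i j\<bar>) + c) * (deviation + sqrt deviation)"
proof -
  note y0 = deviation_nonneg real_sqrt_ge_zero[OF deviation_nonneg]
  let ?R = "\<lambda>i. P (r + i)" and ?S = "\<lambda>i. Q (r + i)"
  have m: "m = r + (m - r)" and n: "n = r + (n - r)" using nm rk kq qn by auto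
  have "trace_pairing m n k B P Q \<le> (\<Sum>i<m. \<Sum>j<n. B i j * (if i < r \<or> j < r then (if i = j then 1 else 0) else dot k (P i) (Q j)))
     + (\<Sum>i<m. \<Sum>j<n. \<bar>B i j\<bar>) * (2 * (deviation + sqrt deviation))"
  proof (rule trace_pairing_perturb, goal_cases)
    case (1 i j)
    show ?case
    proof (cases "i < r \<or> j < r")
      case True
      have "deviation + 2 * sqrt deviation \<le> 2 * (deviation + sqrt deviation)" using y0(1) by simp
      then show ?thesis using order_trans[OF top_entries[OF 1 True]] True by simp
    next
      case False
      then show ?thesis using y0 by simp
    qed
  qed
  also have "(\<Sum>i<m. \<Sum>j<n. B i j * (if i < r \<or> j < r then (if i = j then 1 else 0) else dot k (P i) (Q j))) =
    (\<Sum>i<r. B i i) + trace_pairing (m - r) (n - r) k (\<lambda>i j. B (r + i) (r + j)) ?R ?S"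
    unfolding trace_pairing_def by (rule sum_first_block_identity)
  also have "trace_pairing (m - r) (n - r) k (\<lambda>i j. B (r + i) (r + j)) ?R ?S \<le>
      D + c * (((\<Sum>i<m - r. dot k (?R i) (?R i)) + (\<Sum>j<n - r. dot k (?S j) (?S j))) / 2 - real (k - r))"
    using rk kq qn nm by (intro spec contraction_rows[OF P] contraction_rows[OF Q]) auto
  also have "c * (((\<Sum>i<m - r. dot k (?R i) (?R i)) + (\<Sum>j<n - r. dot k (?S j) (?S j))) / 2 - real (k - r)) \<le> c * (deviation + sqrt deviation)"
  proof (rule mult_left_mono[OF _ c])
    have 1: "(\<Sum>i<r. dot k (P i) (P i)) + (\<Sum>i<m - r. dot k (?R i) (?R i)) \<le> real k"
      using contraction_frobenius[OF P] by (subst (asm) m, subst (asm) sum_lessThan_add)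
    have 2: "(\<Sum>i<r. dot k (Q i) (Q i)) + (\<Sum>i<n - r. dot k (?S i) (?S i)) \<le> real k"
      using contraction_frobenius[OF Q] by (subst (asm) n, subst (asm) sum_lessThan_add)
    have 3: "(\<Sum>i<r. 1 - mass i) = real r - ((\<Sum>i<r. dot k (P i) (P i)) + (\<Sum>i<r. dot k (Q i) (Q i))) / 2"
      by (simp add: mass_def sum_subtractf sum_divide_distrib[symmetric] sum.distrib)
    have "real (k - r) = real k - real r" using rk by simp
    then show "((\<Sum>i<m - r. dot k (?R i) (?R i)) + (\<Sum>j<n - r. dot k (?S j) (?S j))) / 2 - real (k - r) \<le> deviation + sqrt deviation"
      using 1 2 3 top_sum_le slack_le_deviation slack_nonneg y0 by argo
  qed
  finally show ?thesis by (simp add: algebra_simps)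
qed

end

section \<open>Directional derivative at a diagonal matrix\<close>

lemma dot_block_id_block_id:
  "i < r \<Longrightarrow> j < r \<Longrightarrow> dot (r + t) (block_id r G i) (block_id r H j) = (if i = j then 1 else 0)"
  "i < r \<Longrightarrow> dot (r + t) (block_id r G i) (block_id r H (r + j)) = 0"
  "j < r \<Longrightarrow> dot (r + t) (block_id r G (r + i)) (block_id r H j) = 0"
  "dot (r + t) (block_id r G (r + i)) (block_id r H (r + j)) = dot t (G i) (H j)"
  by (simp_all add: dot_block_id) (auto simp: block_id_def dot_def)

lemma trace_pairing_block_id:
  "trace_pairing (r + m) (r + n) (r + t) X (block_id r G) (block_id r H) =
    (\<Sum>i<r. X i i) + trace_pairing m n t (\<lambda>i j. X (r + i) (r + j)) G H"
proof -
  have 1: "(\<Sum>i<r. \<Sum>j<r. X i j * dot (r + t) (block_id r G i) (block_id r H j)) = (\<Sum>i<r. X i i)"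
    by (intro sum.cong refl) (simp add: dot_block_id_block_id if_distrib[of "\<lambda>x. _ * x"] cong: if_cong)
  show ?thesis
    unfolding trace_pairing_def sum_lessThan_add by (simp add: dot_block_id_block_id(2-4) sum.distrib 1)
qed

text \<open>Half of \<open>e y\<close> pays for the linear term, since \<open>\<tau>\<close> is small; the other half pays for
  \<open>\<tau> C \<surd>y\<close> up to the constant that completes the square.\<close>

lemma quadratic_absorbs:
  fixes e C \<tau> y :: real
  assumes e: "0 < e" and C: "0 \<le> C" and \<tau>: "0 \<le> \<tau>" "2 * C * \<tau> \<le> e" and y: "0 \<le> y"
  shows "\<tau> * (C * (y + sqrt y)) - e * y \<le> C\<^sup>2 / (2 * e) * \<tau>\<^sup>2"
proof -
  define u where "u = sqrt y"
  have yu: "y = u * u" using y by (simp add: u_def)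
  have "\<tau> * C * y \<le> e / 2 * y" using \<tau>(2) y by (intro mult_right_mono) (simp_all add: mult_ac)
  moreover have "0 \<le> (e * u - \<tau> * C)\<^sup>2 / (2 * e)" using e by simp
  then have "\<tau> * C * u \<le> e / 2 * y + C\<^sup>2 / (2 * e) * \<tau>\<^sup>2"
    using e unfolding yu by (simp add: power2_eq_square field_simps)
  ultimately show ?thesis unfolding u_def[symmetric] by (simp add: algebra_simps)
qed

lemma gateaux_quotient_tendsto:
  assumes "0 < \<tau>0"
    and "\<And>\<tau>. 0 < \<tau> \<Longrightarrow> \<tau> < \<tau>0 \<Longrightarrow> \<phi> X + \<tau> * D \<le> \<phi> (X + \<tau> \<cdot>\<^sub>m U)"
    and "\<And>\<tau>. 0 < \<tau> \<Longrightarrow> \<tau> < \<tau>0 \<Longrightarrow> \<phi> (X + \<tau> \<cdot>\<^sub>m U) \<le> \<phi> X + \<tau> * D + K * \<tau>\<^sup>2"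
  shows "(gateaux_quotient \<phi> U X \<longlongrightarrow> D) (at_right 0)"
proof (rule tendsto_sandwich[of "\<lambda>_. D" _ _ "\<lambda>\<tau>. D + K * \<tau>"])
  have ev: "\<forall>\<^sub>F \<tau> in at_right 0. 0 < \<tau> \<and> \<tau> < \<tau>0"
    using assms(1) by (auto simp: eventually_at_right_field)
  show "\<forall>\<^sub>F \<tau> in at_right 0. D \<le> gateaux_quotient \<phi> U X \<tau>"
    using ev
  proof eventually_elim
    case (elim \<tau>)
    then show ?case using assms(2)[of \<tau>] by (simp add: gateaux_quotient_def pos_le_divide_eq mult.commute)
  qed
  show "\<forall>\<^sub>F \<tau> in at_right 0. gateaux_quotient \<phi> U X \<tau> \<le> D + K * \<tau>"
    using ev
  proof eventually_elim
    case (elim \<tau>)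
    then show ?case using assms(3)[of \<tau>]
      by (simp add: gateaux_quotient_def pos_divide_le_eq algebra_simps power2_eq_square)
  qed
  have "((\<lambda>\<tau>. D + K * \<tau>) \<longlongrightarrow> D + K * 0) (at_right 0)"
    by (intro tendsto_intros)
  then show "((\<lambda>\<tau>. D + K * \<tau>) \<longlongrightarrow> D) (at_right 0)" by simp
qed simp

context singular_block
begin

lemma trace_pairing_diagonal:
  assumes "\<And>i j. i < m \<Longrightarrow> j < n \<Longrightarrow> X i j = (if i = j then s i else 0)"
  shows "trace_pairing m n k' X P Q = (\<Sum>i<n. s i * dot k' (P i) (Q i))"
proof -
  have "trace_pairing m n k' X P Q = (\<Sum>i<m. \<Sum>j<n. if j = i then s i * dot k' (P i) (Q i) else 0)"
    unfolding trace_pairing_def using assms by (intro sum.cong refl) auto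
  also have "\<dots> = (\<Sum>i<m. if i < n then s i * dot k' (P i) (Q i) else 0)"
    by (intro sum.cong refl) (simp add: sum.delta)
  also have "\<dots> = (\<Sum>i<n. if i < n then s i * dot k' (P i) (Q i) else 0)"
    using nm by (intro sum.mono_neutral_right) auto
  finally show ?thesis by simp
qed

text \<open>The squeeze. The pair \<open>P'\<close>, \<open>Q'\<close> is optimal at \<open>S\<close> and has slope \<open>D\<close>; this is the lower bound. For the
  upper bound take the optimal pair at \<open>S + \<tau> B\<close> and weigh its gain in slope against its loss at \<open>S\<close>.\<close>

lemma ky_fan_directional_limit:
  assumes S: "S \<in> carrier_mat m n" and B: "B \<in> carrier_mat m n"
    and Sd: "\<And>i j. i < m \<Longrightarrow> j < n \<Longrightarrow> S $$ (i, j) = (if i = j then s i else 0)"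
    and norm: "ky_fan_norm k S = (\<Sum>i<k. s i)"
    and C: "0 \<le> C"
    and upper: "\<And>P Q. contracted_singular_block m n r q k s h g P Q \<Longrightarrow>
      trace_pairing m n k (\<lambda>i j. B $$ (i, j)) P Q \<le> D + C * (contracted_singular_block.deviation n r q k s h g P Q
        + sqrt (contracted_singular_block.deviation n r q k s h g P Q))"
    and P': "contraction m k P'" and Q': "contraction n k Q'"
    and lower: "trace_pairing m n k (\<lambda>i j. S $$ (i, j)) P' Q' = (\<Sum>i<k. s i)"
      "trace_pairing m n k (\<lambda>i j. B $$ (i, j)) P' Q' = D"
  shows "(gateaux_quotient (ky_fan_norm k) B S \<longlongrightarrow> D) (at_right 0)"
proof -
  define e where "e = g\<^sup>2 / 2"
  have e: "0 < e" using g0 by (simp add: e_def)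
  \<comment> \<open>Small enough for \<open>quadratic_absorbs\<close>; the summand 1 only avoids a zero denominator.\<close>
  define \<tau>0 where "\<tau>0 = e / (2 * C + 1)"
  have k: "1 \<le> k" "k \<le> n" using rk kq qn by auto
  show ?thesis
  proof (rule gateaux_quotient_tendsto)
    show "0 < \<tau>0" using e C by (simp add: \<tau>0_def)
  next
    fix \<tau> :: real
    assume \<tau>: "0 < \<tau>" "\<tau> < \<tau>0"
    have c: "S + \<tau> \<cdot>\<^sub>m B \<in> carrier_mat m n" using S B by simp
    have "trace_pairing m n k (\<lambda>i j. (S + \<tau> \<cdot>\<^sub>m B) $$ (i, j)) P' Q' \<le> ky_fan_norm k (S + \<tau> \<cdot>\<^sub>m B)"
      by (rule trace_pairing_le_ky_fan_norm[OF c k P' Q'])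
    then show "ky_fan_norm k S + \<tau> * D \<le> ky_fan_norm k (S + \<tau> \<cdot>\<^sub>m B)"
      unfolding trace_pairing_add_smult[OF S B] lower norm .
  next
    fix \<tau> :: real
    assume \<tau>: "0 < \<tau>" "\<tau> < \<tau>0"
    have c: "S + \<tau> \<cdot>\<^sub>m B \<in> carrier_mat m n" using S B by simp
    obtain P Q where P: "contraction m k P" and Q: "contraction n k Q" and
      PQ: "trace_pairing m n k (\<lambda>i j. (S + \<tau> \<cdot>\<^sub>m B) $$ (i, j)) P Q = ky_fan_norm k (S + \<tau> \<cdot>\<^sub>m B)"
      using ky_fan_norm_attained[OF c k(2)] .
    interpret contracted_singular_block m n r q k s h g P Q
      by unfold_locales (rule P, rule Q)
    have "(2 * C + 1) * \<tau> < e" using \<tau>(2) C by (simp add: \<tau>0_def pos_less_divide_eq mult.commute)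
    then have small: "2 * C * \<tau> \<le> e" using \<tau>(1) by (simp add: distrib_right)
    have "ky_fan_norm k (S + \<tau> \<cdot>\<^sub>m B) =
        (\<Sum>i<n. s i * dot k (P i) (Q i)) + \<tau> * trace_pairing m n k (\<lambda>i j. B $$ (i, j)) P Q"
      unfolding PQ[symmetric] trace_pairing_add_smult[OF S B] by (subst trace_pairing_diagonal[OF Sd]) simp_all
    also have "\<dots> \<le> ((\<Sum>i<k. s i) - g * slack) + \<tau> * (D + C * (deviation + sqrt deviation))"
      using \<tau>(1) by (intro add_mono diagonal_loss mult_left_mono upper contracted_singular_block_axioms) simp
    also have "\<dots> = (\<Sum>i<k. s i) + \<tau> * D + (\<tau> * (C * (deviation + sqrt deviation)) - e * deviation)"
      unfolding g_slack e_def by (simp add: distrib_left)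
    also have "\<dots> \<le> (\<Sum>i<k. s i) + \<tau> * D + C\<^sup>2 / (2 * e) * \<tau>\<^sup>2"
      using quadratic_absorbs[OF e C _ small deviation_nonneg] \<tau>(1) by simp
    finally show "ky_fan_norm k (S + \<tau> \<cdot>\<^sub>m B) \<le> ky_fan_norm k S + \<tau> * D + C\<^sup>2 / (2 * e) * \<tau>\<^sup>2"
      unfolding norm .
  qed
qed

lemma sum_top_k: "(\<Sum>i<k. s i) = (\<Sum>i<r. s i) + real (k - r) * h"
proof -
  have "(\<Sum>i<k. s i) = (\<Sum>i<r + (k - r). s i)" using rk by simp
  also have "\<dots> = (\<Sum>i<r. s i) + (\<Sum>i<k - r. s (r + i))" by (rule sum_lessThan_add)
  also have "(\<Sum>i<k - r. s (r + i)) = (\<Sum>i<k - r. h)" using mid rk kq by (intro sum.cong refl) auto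
  finally show ?thesis by simp
qed

text \<open>The trailing block of \<open>S\<close> vanishes, so an optimal pair for \<open>N\<close> may be inserted there without loss.\<close>

lemma ky_fan_directional_limit_zero_level:
  assumes S: "S \<in> carrier_mat m n" and B: "B \<in> carrier_mat m n"
    and Sd: "\<And>i j. i < m \<Longrightarrow> j < n \<Longrightarrow> S $$ (i, j) = (if i = j then s i else 0)"
    and norm: "ky_fan_norm k S = (\<Sum>i<k. s i)"
    and h: "h = 0" and q: "q = n"
    and N: "N \<in> carrier_mat (m - r) (n - r)"
    and NB: "\<And>i j. i < m - r \<Longrightarrow> j < n - r \<Longrightarrow> N $$ (i, j) = B $$ (r + i, r + j)"
  shows "(gateaux_quotient (ky_fan_norm k) B S \<longlongrightarrow>
      (\<Sum>i<r. B $$ (i, i)) + ky_fan_norm (k - r) N) (at_right 0)"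
proof -
  let ?t = "k - r" and ?c = "singular_value N (k - r)"
  have t: "1 \<le> ?t" "?t \<le> n - r" using rk kq qn by auto
  have t1: "Suc (?t - 1) = ?t" and "?t - 1 < n - r" using t by auto
  then have c: "0 \<le> ?c" using singular_value_nonneg[OF N, of "?t - 1"] unfolding t1 by blast
  have mr: "r + (m - r) = m" and nr: "r + (n - r) = n" and kr: "r + ?t = k" using rk kq qn nm by auto
  obtain G H where G: "contraction (m - r) ?t G" and H: "contraction (n - r) ?t H" and
    GH: "trace_pairing (m - r) (n - r) ?t (\<lambda>i j. N $$ (i, j)) G H = ky_fan_norm ?t N"
    using ky_fan_norm_attained[OF N t(2)] .
  let ?P = "block_id r G" and ?Q = "block_id r H"
  let ?\<beta> = "\<Sum>i<m. \<Sum>j<n. \<bar>B $$ (i, j)\<bar>"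
  have NB': "trace_pairing (m - r) (n - r) k' (\<lambda>i j. N $$ (i, j)) P Q = trace_pairing (m - r) (n - r) k' (\<lambda>i j. B $$ (r + i, r + j)) P Q"
    for k' P Q by (rule trace_pairing_cong[OF NB])
  show ?thesis
  proof (rule ky_fan_directional_limit[OF S B Sd norm, where P' = ?P and Q' = ?Q and C = "2 * ?\<beta> + ?c"])
    show "0 \<le> 2 * ?\<beta> + ?c" using c by (simp add: sum_nonneg)
  next
    fix P Q
    assume "contracted_singular_block m n r q k s h g P Q"
    then interpret contracted_singular_block m n r q k s h g P Q .
    show "trace_pairing m n k (\<lambda>i j. B $$ (i, j)) P Q \<le>
      (\<Sum>i<r. B $$ (i, i)) + ky_fan_norm ?t N + (2 * ?\<beta> + ?c) * (deviation + sqrt deviation)"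
    proof (rule zero_level_bound[OF c])
      fix R T assume "contraction (m - r) k R" "contraction (n - r) k T"
      from trace_pairing_le_singular_values[OF N this t]
      show "trace_pairing (m - r) (n - r) k (\<lambda>i j. B $$ (r + i, r + j)) R T \<le> ky_fan_norm ?t N +
        ?c * (((\<Sum>i<m - r. dot k (R i) (R i)) + (\<Sum>j<n - r. dot k (T j) (T j))) / 2 - real ?t)"
        unfolding NB' ky_fan_norm_eq .
    qed
  next
    show "contraction m k ?P" using contraction_block_id[OF G, of r] unfolding mr kr .
    show "contraction n k ?Q" using contraction_block_id[OF H, of r] unfolding nr kr .
  next
    have 0: "trace_pairing (m - r) (n - r) ?t (\<lambda>i j. S $$ (r + i, r + j)) G H = 0"
      unfolding trace_pairing_def using Sd mid q h by (intro sum.neutral ballI) auto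
    have "trace_pairing m n k (\<lambda>i j. S $$ (i, j)) ?P ?Q = (\<Sum>i<r. S $$ (i, i))"
      using trace_pairing_block_id[of r "m - r" "n - r" ?t "\<lambda>i j. S $$ (i, j)" G H] unfolding mr nr kr 0 by simp
    also have "\<dots> = (\<Sum>i<r. s i)" using Sd rk kq qn nm by (intro sum.cong refl) auto
    finally show "trace_pairing m n k (\<lambda>i j. S $$ (i, j)) ?P ?Q = (\<Sum>i<k. s i)"
      unfolding sum_top_k h by simp
    show "trace_pairing m n k (\<lambda>i j. B $$ (i, j)) ?P ?Q = (\<Sum>i<r. B $$ (i, i)) + ky_fan_norm ?t N"
      using trace_pairing_block_id[of r "m - r" "n - r" ?t "\<lambda>i j. B $$ (i, j)" G H] GH
      unfolding mr nr kr NB' by simp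
  qed
qed

end

lemma trace_pairing_symmetric_part:
  assumes "\<And>i j. i < p \<Longrightarrow> j < p \<Longrightarrow> Y i j = (X i j + X j i) / 2"
  shows "trace_pairing p p k Y P P = trace_pairing p p k X P P"
proof -
  have "(\<Sum>i<p. \<Sum>j<p. X j i * dot k (P i) (P j)) = (\<Sum>i<p. \<Sum>j<p. X i j * dot k (P i) (P j))"
    by (subst sum.swap) (simp add: dot_commute)
  moreover have "trace_pairing p p k Y P P =
    ((\<Sum>i<p. \<Sum>j<p. X i j * dot k (P i) (P j)) + (\<Sum>i<p. \<Sum>j<p. X j i * dot k (P i) (P j))) / 2"
    unfolding trace_pairing_def sum.distrib[symmetric] sum_divide_distrib
    by (intro sum.cong refl) (simp add: assms algebra_simps add_divide_distrib)
  ultimately show ?thesis by (simp add: trace_pairing_def)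
qed

context singular_block
begin

text \<open>On the middle block \<open>S\<close> is \<open>h\<close> times the identity, so any \<open>k - r\<close> orthonormal vectors, used
  in both \<open>P\<close> and \<open>Q\<close>, are optimal there; the top eigenvectors of \<open>M\<close> give the largest slope.\<close>

lemma ky_fan_directional_limit_positive_level:
  assumes S: "S \<in> carrier_mat m n" and B: "B \<in> carrier_mat m n"
    and Sd: "\<And>i j. i < m \<Longrightarrow> j < n \<Longrightarrow> S $$ (i, j) = (if i = j then s i else 0)"
    and norm: "ky_fan_norm k S = (\<Sum>i<k. s i)"
    and h: "h \<noteq> 0"
    and M: "M \<in> carrier_mat (q - r) (q - r)"
    and MB: "\<And>i j. i < q - r \<Longrightarrow> j < q - r \<Longrightarrow> M $$ (i, j) = (B $$ (r + i, r + j) + B $$ (r + j, r + i)) / 2"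
  shows "(gateaux_quotient (ky_fan_norm k) B S \<longlongrightarrow>
      (\<Sum>i<r. B $$ (i, i)) + (\<Sum>l<k - r. eigenvalue_desc M (Suc l))) (at_right 0)"
proof -
  let ?t = "k - r" and ?p = "q - r"
  let ?c = "eigenvalue_desc M ?t"
  have t: "1 \<le> ?t" "?t \<le> ?p" using rk kq qn by auto
  have t1: "Suc (?t - 1) = ?t" using t by simp
  have mr: "r + (m - r) = m" and nr: "r + (n - r) = n" and kr: "r + ?t = k" using rk kq qn nm by auto
  have Msym: "M\<^sup>T = M"
  proof (rule eq_matI)
    fix i j assume "i < dim_row M" "j < dim_col M"
    then have "i < ?p" "j < ?p" using M by auto
    then show "M\<^sup>T $$ (i, j) = M $$ (i, j)"
      using M MB[of i j] MB[of j i] by (simp add: add.commute)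
  qed (use M in auto)
  obtain E where Eg: "orthonormal_mat ?p E \<and> (\<forall>i<?p. \<forall>j<?p.
      M $$ (i, j) = (\<Sum>l<?p. eigenvalue_desc M (Suc l) * (E $$ (i, l) * E $$ (j, l))))"
    using spectral_expansion[OF M Msym] ..
  note E = Eg[THEN conjunct1] and ME = Eg[THEN conjunct2, rule_format]
  have MB': "trace_pairing ?p ?p k' (\<lambda>i j. B $$ (r + i, r + j)) P P = trace_pairing ?p ?p k' (\<lambda>i j. M $$ (i, j)) P P" for k' P
    by (rule trace_pairing_symmetric_part[symmetric]) (rule MB)
  let ?e = "\<lambda>i l. E $$ (i, l)"
  \<comment> \<open>The eigenvectors padded with zero rows, since the trailing parts of \<open>P\<close> and \<open>Q\<close> may have
    more rows than \<open>M\<close>.\<close>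
  define G where "G i l = (if i < ?p then E $$ (i, l) else 0)" for i l
  have G_outside: "dot k' (G i) x = 0" "dot k' x (G i) = 0" if "?p \<le> i" for i k' x
    using that by (simp_all add: G_def dot_def)
  have G_inside: "G i = E_row i" if "i < ?p" "E_row = ?e" for i E_row
    using that by (simp add: G_def fun_eq_iff)
  have contraction_G: "contraction a ?t G" if "?p \<le> a" for a
    unfolding contraction_def
  proof
    fix c
    have "(\<Sum>i<a. (dot ?t (G i) c)\<^sup>2) = (\<Sum>i<?p. (dot ?t (G i) c)\<^sup>2)"
      using that G_outside by (intro sum.mono_neutral_right) auto
    also have "\<dots> = (\<Sum>i<?p. (dot ?t (?e i) c)\<^sup>2)" by (simp add: G_inside)
    also have "\<dots> \<le> dot ?t c c" by (rule contractionD[OF contraction_orthonormal_mat[OF E t(2)]])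
    finally show "(\<Sum>i<a. (dot ?t (G i) c)\<^sup>2) \<le> dot ?t c c" .
  qed
  have restrict: "trace_pairing (m - r) (n - r) ?t X G G = trace_pairing ?p ?p ?t X ?e ?e" for X
  proof -
    have "trace_pairing (m - r) (n - r) ?t X G G = (\<Sum>i<m - r. \<Sum>j<?p. X i j * dot ?t (G i) (G j))"
      unfolding trace_pairing_def using G_outside qn
      by (intro sum.cong refl sum.mono_neutral_right) auto
    also have "\<dots> = (\<Sum>i<?p. \<Sum>j<?p. X i j * dot ?t (G i) (G j))"
      using G_outside qn nm by (intro sum.mono_neutral_right) (auto intro!: sum.neutral)
    finally show ?thesis by (simp add: trace_pairing_def G_inside)
  qed
  let ?P = "block_id r G"
  let ?\<beta> = "\<Sum>i<m. \<Sum>j<n. \<bar>B $$ (i, j)\<bar>"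
  show ?thesis
  proof (rule ky_fan_directional_limit[OF S B Sd norm, where P' = ?P and Q' = ?P and C = "2 * ?\<beta> + 2 * \<bar>?c\<bar>"])
    show "0 \<le> 2 * ?\<beta> + 2 * \<bar>?c\<bar>" by (simp add: sum_nonneg)
  next
    fix P Q
    assume "contracted_singular_block m n r q k s h g P Q"
    then interpret contracted_singular_block m n r q k s h g P Q .
    show "trace_pairing m n k (\<lambda>i j. B $$ (i, j)) P Q \<le>
      (\<Sum>i<r. B $$ (i, i)) + (\<Sum>l<?t. eigenvalue_desc M (Suc l)) + (2 * ?\<beta> + 2 * \<bar>?c\<bar>) * (deviation + sqrt deviation)"
    proof (rule positive_level_bound[OF h])
      fix R assume R: "contraction ?p k R"
      have "trace_pairing ?p ?p k (\<lambda>i j. M $$ (i, j)) R R \<le> (\<Sum>l<?t. eigenvalue_desc M (Suc l)) +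
        eigenvalue_desc M (Suc (?t - 1)) * ((\<Sum>i<?p. dot k (R i) (R i)) - real ?t)"
        by (rule trace_pairing_le_spectral[where X = "\<lambda>i j. M $$ (i, j)" and a = "\<lambda>l. eigenvalue_desc M (Suc l)" and g = ?e,
            OF ME contraction_orthonormal_mat[OF E order_refl] orthonormal_mat_dot(2)[OF E]
            eigenvalue_desc_antimono[OF M Msym] R t])
      then show "trace_pairing ?p ?p k (\<lambda>i j. B $$ (r + i, r + j)) R R \<le> (\<Sum>l<?t. eigenvalue_desc M (Suc l)) +
        ?c * ((\<Sum>i<?p. dot k (R i) (R i)) - real ?t)"
        unfolding MB' t1 .
    qed
  next
    show "contraction m k ?P" using contraction_block_id[OF contraction_G, of "m - r" r] qn nm unfolding mr kr by simp
    show "contraction n k ?P" using contraction_block_id[OF contraction_G, of "n - r" r] qn unfolding nr kr by simp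
  next
    have "trace_pairing (m - r) (n - r) ?t (\<lambda>i j. S $$ (r + i, r + j)) G G =
        (\<Sum>i<?p. \<Sum>j<?p. if j = i then h * dot ?t (?e i) (?e i) else 0)"
      unfolding restrict unfolding trace_pairing_def
    proof (intro sum.cong refl, goal_cases)
      case (1 i j)
      then show ?case using Sd[of "r + i" "r + j"] mid[of "r + i"] rk kq qn nm by auto
    qed
    also have "\<dots> = h * (\<Sum>i<?p. dot ?t (?e i) (?e i))" by (simp add: sum_distrib_left)
    also have "(\<Sum>i<?p. dot ?t (?e i) (?e i)) = (\<Sum>l<?t. dot ?p (\<lambda>i. ?e i l) (\<lambda>i. ?e i l))"
      unfolding dot_def by (rule sum.swap)
    also have "\<dots> = (\<Sum>l<?t. 1)"
    proof (intro sum.cong refl, goal_cases)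
      case (1 l)
      then show ?case using orthonormal_mat_dot(1)[OF E, of l l] t by simp
    qed
    finally have Sblock: "trace_pairing (m - r) (n - r) ?t (\<lambda>i j. S $$ (r + i, r + j)) G G = real ?t * h" by simp
    have "trace_pairing m n k (\<lambda>i j. S $$ (i, j)) ?P ?P = (\<Sum>i<r. S $$ (i, i)) + real ?t * h"
      using trace_pairing_block_id[of r "m - r" "n - r" ?t "\<lambda>i j. S $$ (i, j)" G G] unfolding mr nr kr Sblock by simp
    also have "(\<Sum>i<r. S $$ (i, i)) = (\<Sum>i<r. s i)" using Sd rk kq qn nm by (intro sum.cong refl) auto
    finally show "trace_pairing m n k (\<lambda>i j. S $$ (i, j)) ?P ?P = (\<Sum>i<k. s i)"
      unfolding sum_top_k .
  next
    have "trace_pairing ?p ?p ?t (\<lambda>i j. M $$ (i, j)) ?e ?e = (\<Sum>l<?p. eigenvalue_desc M (Suc l) *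
        dot ?t (\<lambda>c. dot ?p (\<lambda>i. ?e i l) (\<lambda>i. ?e i c)) (\<lambda>c. dot ?p (\<lambda>i. ?e i l) (\<lambda>i. ?e i c)))"
      by (rule trace_pairing_rank_one_expansion[OF ME])
    also have "\<dots> = (\<Sum>l<?p. if l < ?t then eigenvalue_desc M (Suc l) else 0)"
    proof (intro sum.cong refl, goal_cases)
      case (1 l)
      have "dot ?t (\<lambda>c. dot ?p (\<lambda>i. ?e i l) (\<lambda>i. ?e i c)) (\<lambda>c. dot ?p (\<lambda>i. ?e i l) (\<lambda>i. ?e i c)) =
        (\<Sum>c<?t. if c = l then 1 else 0)"
        unfolding dot_def[of ?t]
      proof (intro sum.cong refl, goal_cases)
        case (1 c)
        then show ?case using orthonormal_mat_dot(1)[OF E, of l c] \<open>l \<in> {..<?p}\<close> t by simp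
      qed
      then show ?case by (simp add: sum.delta)
    qed
    also have "\<dots> = (\<Sum>l\<in>{..<?p} \<inter> {l. l < ?t}. eigenvalue_desc M (Suc l))"
      by (simp only: sum.inter_restrict finite_lessThan mem_Collect_eq)
    also have "{..<?p} \<inter> {l. l < ?t} = {..<?t}" using t by auto
    finally have Mblock: "trace_pairing ?p ?p ?t (\<lambda>i j. M $$ (i, j)) ?e ?e = (\<Sum>l<?t. eigenvalue_desc M (Suc l))" .
    show "trace_pairing m n k (\<lambda>i j. B $$ (i, j)) ?P ?P = (\<Sum>i<r. B $$ (i, i)) + (\<Sum>l<?t. eigenvalue_desc M (Suc l))"
      using trace_pairing_block_id[of r "m - r" "n - r" ?t "\<lambda>i j. B $$ (i, j)" G G]
      unfolding mr nr kr restrict MB' Mblock .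
  qed
qed

end

section \<open>Reduction to the diagonal case\<close>

lemma col_range_carrier:
  assumes "X \<in> carrier_mat a b"
  shows "col_range X (Suc c) d \<in> carrier_mat a (d - c)"
  unfolding col_range_def using assms by (simp add: mat_of_cols_def del: upt_Suc)

lemma col_range_index:
  assumes "X \<in> carrier_mat a b" "x < a" "i < d - c" "d \<le> b"
  shows "col_range X (Suc c) d $$ (x, i) = X $$ (x, c + i)"
  using assms by (simp add: col_range_def mat_of_cols_def del: upt_Suc)

lemma index_mult_sum:
  assumes "X \<in> carrier_mat m n" "Y \<in> carrier_mat n p" "i < m" "j < p"
  shows "(X * Y) $$ (i, j) = (\<Sum>l<n. X $$ (i, l) * Y $$ (l, j))"
  using assms by (simp add: scalar_prod_def atLeast0LessThan)

lemma mult_transpose_left_index: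
  assumes "X \<in> carrier_mat m p" "A \<in> carrier_mat m n" "Y \<in> carrier_mat n p'" "i < p" "j < p'"
  shows "(X\<^sup>T * A * Y) $$ (i, j) = (\<Sum>b<n. (\<Sum>a<m. X $$ (a, i) * A $$ (a, b)) * Y $$ (b, j))"
proof -
  have "(X\<^sup>T * A * Y) $$ (i, j) = (\<Sum>b<n. (X\<^sup>T * A) $$ (i, b) * Y $$ (b, j))"
    by (rule index_mult_sum[of _ p]) (use assms in auto)
  also have "\<dots> = (\<Sum>b<n. (\<Sum>a<m. X $$ (a, i) * A $$ (a, b)) * Y $$ (b, j))"
    using assms by (intro sum.cong refl) (simp add: scalar_prod_def atLeast0LessThan)
  finally show ?thesis .
qed

text \<open>Column ranges are numbered from 1 and matrix entries from 0, whence the successor.\<close>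

lemma col_range_compression_index:
  assumes U: "U \<in> carrier_mat m b" and A: "A \<in> carrier_mat m n" and V: "V \<in> carrier_mat n b'"
    and "p \<le> b" "p' \<le> b'" and ij: "i < p - c" "j < p' - c'"
  shows "((col_range U (Suc c) p)\<^sup>T * A * col_range V (Suc c') p') $$ (i, j) = (U\<^sup>T * A * V) $$ (c + i, c' + j)"
proof -
  have "((col_range U (Suc c) p)\<^sup>T * A * col_range V (Suc c') p') $$ (i, j) =
     (\<Sum>y<n. (\<Sum>x<m. U $$ (x, c + i) * A $$ (x, y)) * V $$ (y, c' + j))"
    unfolding mult_transpose_left_index[OF col_range_carrier[OF U] A col_range_carrier[OF V] ij]
    using assms by (intro sum.cong refl arg_cong2[of _ _ _ _ "(*)"]) (simp_all add: col_range_index[OF U] col_range_index[OF V])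
  also have "\<dots> = (U\<^sup>T * A * V) $$ (c + i, c' + j)"
    by (rule mult_transpose_left_index[OF U A V, symmetric]) (use assms in auto)
  finally show ?thesis .
qed

lemma mat_inner_col_range:
  assumes U: "U \<in> carrier_mat m m" and A: "A \<in> carrier_mat m n" and V: "V \<in> carrier_mat n n"
    and r: "r \<le> m" "r \<le> n"
  shows "mat_inner (col_range U 1 r * (col_range V 1 r)\<^sup>T) A = (\<Sum>i<r. (U\<^sup>T * A * V) $$ (i, i))"
proof -
  let ?U = "col_range U 1 r" and ?V = "col_range V 1 r"
  have Uc: "?U \<in> carrier_mat m r" and Vc: "?V \<in> carrier_mat n r"
    using col_range_carrier[OF U, of 0 r] col_range_carrier[OF V, of 0 r] by simp_all
  have W: "?U * ?V\<^sup>T \<in> carrier_mat m n" using Uc Vc by simp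
  then have Wt: "(?U * ?V\<^sup>T)\<^sup>T \<in> carrier_mat n m" by simp
  have Wi: "(?U * ?V\<^sup>T) $$ (a, b) = (\<Sum>i<r. U $$ (a, i) * V $$ (b, i))" if "a < m" "b < n" for a b
    unfolding index_mult_transpose[OF Uc Vc that]
    using col_range_index[OF U that(1), of _ r 0] col_range_index[OF V that(2), of _ r 0] r
    by (intro sum.cong refl) simp
  have "mat_inner (?U * ?V\<^sup>T) A = (\<Sum>b<n. \<Sum>a<m. (?U * ?V\<^sup>T) $$ (a, b) * A $$ (a, b))"
    unfolding mat_inner_def trace_mat_def carrier_matD(1)[OF mult_carrier_mat[OF Wt A]]
  proof (intro sum.cong refl, goal_cases)
    case (1 b)
    then have "((?U * ?V\<^sup>T)\<^sup>T * A) $$ (b, b) = (\<Sum>a<m. (?U * ?V\<^sup>T)\<^sup>T $$ (b, a) * A $$ (a, b))"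
      by (intro index_mult_sum[OF Wt A]) auto
    also have "\<dots> = (\<Sum>a<m. (?U * ?V\<^sup>T) $$ (a, b) * A $$ (a, b))"
      using 1 W by (intro sum.cong refl arg_cong2[of _ _ _ _ "(*)"] index_transpose_mat) auto
    finally show ?case .
  qed
  also have "\<dots> = (\<Sum>b<n. \<Sum>a<m. \<Sum>i<r. U $$ (a, i) * A $$ (a, b) * V $$ (b, i))"
    by (intro sum.cong refl) (simp only: lessThan_iff Wi sum_distrib_left sum_distrib_right mult_ac)
  also have "\<dots> = (\<Sum>b<n. \<Sum>i<r. \<Sum>a<m. U $$ (a, i) * A $$ (a, b) * V $$ (b, i))"
    by (intro sum.cong refl sum.swap)
  also have "\<dots> = (\<Sum>i<r. \<Sum>b<n. \<Sum>a<m. U $$ (a, i) * A $$ (a, b) * V $$ (b, i))"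
    by (rule sum.swap)
  also have "\<dots> = (\<Sum>i<r. (U\<^sup>T * A * V) $$ (i, i))"
    using r by (intro sum.cong refl) (simp add: mult_transpose_left_index[OF U A V] sum_distrib_right)
  finally show ?thesis .
qed

lemma exists_singular_gap:
  fixes s :: "nat \<Rightarrow> real"
  assumes "0 \<le> h"
  obtains g where "0 < g" "g \<le> 1" "h \<noteq> 0 \<Longrightarrow> g \<le> h" "\<And>i. i < n \<Longrightarrow> s i \<noteq> h \<Longrightarrow> g \<le> \<bar>s i - h\<bar>"
proof -
  define W where "W = insert 1 (insert (if h = 0 then 1 else h) ((\<lambda>i. \<bar>s i - h\<bar>) ` {i. i < n \<and> s i \<noteq> h}))"
  have fin: "finite W" and ne: "W \<noteq> {}" by (auto simp: W_def)
  have pos: "\<forall>x\<in>W. 0 < x" using assms by (auto simp: W_def)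
  show ?thesis
  proof (rule that[of "Min W"])
    show "0 < Min W" using pos Min_in[OF fin ne] by blast
    show "Min W \<le> 1" by (rule Min_le[OF fin]) (simp add: W_def)
    show "h \<noteq> 0 \<Longrightarrow> Min W \<le> h" by (rule Min_le[OF fin]) (simp add: W_def)
    show "\<And>i. i < n \<Longrightarrow> s i \<noteq> h \<Longrightarrow> Min W \<le> \<bar>s i - h\<bar>" by (rule Min_le[OF fin]) (auto simp: W_def)
  qed
qed

lemma gateaux_derivI:
  assumes "(gateaux_quotient \<phi> U X \<longlongrightarrow> D) (at_right 0)"
  shows "gateaux_exists \<phi> U X \<and> gateaux_deriv \<phi> U X = D"
  using assms tendsto_Lim[OF trivial_limit_at_right_real assms]
  by (auto simp: gateaux_exists_def gateaux_deriv_def)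

text \<open>At the zero matrix the quotient is constant by positive homogeneity.\<close>

lemma ky_fan_quotient_at_zero:
  assumes X: "X \<in> carrier_mat m n" and k: "1 \<le> k" "k \<le> n"
  shows "(gateaux_quotient (ky_fan_norm k) X (0\<^sub>m m n) \<longlongrightarrow> ky_fan_norm k X) (at_right 0)"
    and "ky_fan_norm k (0\<^sub>m m n) = 0"
proof -
  have "0 \<cdot>\<^sub>m X = 0\<^sub>m m n" using X by (intro eq_matI) auto
  then show 0: "ky_fan_norm k (0\<^sub>m m n) = 0"
    using ky_fan_norm_smult_nonneg[OF X k, of 0] by simp
  have "gateaux_quotient (ky_fan_norm k) X (0\<^sub>m m n) \<tau> = ky_fan_norm k X" if "0 < \<tau>" for \<tau>
  proof -
    have "0\<^sub>m m n + \<tau> \<cdot>\<^sub>m X = \<tau> \<cdot>\<^sub>m X" using X by (intro left_add_zero_mat) simp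
    then show ?thesis
      using that ky_fan_norm_smult_nonneg[OF X k, of \<tau>] by (simp add: gateaux_quotient_def 0)
  qed
  then have "\<forall>\<^sub>F \<tau> in at_right 0. gateaux_quotient (ky_fan_norm k) X (0\<^sub>m m n) \<tau> = ky_fan_norm k X"
    by (auto simp: eventually_at_right_field intro: exI[of _ 1])
  then show "(gateaux_quotient (ky_fan_norm k) X (0\<^sub>m m n) \<longlongrightarrow> ky_fan_norm k X) (at_right 0)"
    by (rule tendsto_eventually)
qed

lemma ky_fan_quotient_orthogonal_invariant:
  assumes X: "X \<in> carrier_mat m n" and A: "A \<in> carrier_mat m n"
    and U: "orthonormal_mat m U" and V: "orthonormal_mat n V"
  shows "gateaux_quotient (ky_fan_norm k) (U\<^sup>T * A * V) (U\<^sup>T * X * V) = gateaux_quotient (ky_fan_norm k) A X"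
proof
  fix \<tau>
  note Uc = orthonormal_matD(1)[OF U] and Vc = orthonormal_matD(1)[OF V]
  have Utc: "U\<^sup>T \<in> carrier_mat m m" using Uc by simp
  have "U\<^sup>T * (X + \<tau> \<cdot>\<^sub>m A) = U\<^sup>T * X + \<tau> \<cdot>\<^sub>m (U\<^sup>T * A)"
    using Utc X A by (simp add: mult_add_distrib_mat[of _ m m _ n] mult_smult_distrib[of _ m m _ n])
  then have "U\<^sup>T * (X + \<tau> \<cdot>\<^sub>m A) * V = (U\<^sup>T * X + \<tau> \<cdot>\<^sub>m (U\<^sup>T * A)) * V" by simp
  also have "\<dots> = U\<^sup>T * X * V + (\<tau> \<cdot>\<^sub>m (U\<^sup>T * A)) * V"
    using Utc X A Vc by (intro add_mult_distrib_mat) auto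
  also have "(\<tau> \<cdot>\<^sub>m (U\<^sup>T * A)) * V = \<tau> \<cdot>\<^sub>m (U\<^sup>T * A * V)"
    using Utc A Vc by (intro mult_smult_assoc_mat) auto
  finally have "ky_fan_norm k (U\<^sup>T * X * V + \<tau> \<cdot>\<^sub>m (U\<^sup>T * A * V)) = ky_fan_norm k (X + \<tau> \<cdot>\<^sub>m A)"
    using ky_fan_norm_orthogonal_invariant[of "X + \<tau> \<cdot>\<^sub>m A" m n U V k] X A U V by simp
  then show "gateaux_quotient (ky_fan_norm k) (U\<^sup>T * A * V) (U\<^sup>T * X * V) \<tau> = gateaux_quotient (ky_fan_norm k) A X \<tau>"
    by (simp add: gateaux_quotient_def ky_fan_norm_orthogonal_invariant[OF X U V])
qed

lemma full_svd_rotate: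
  assumes svd: "full_svd m n X U S V"
  shows "U\<^sup>T * X * V = S"
proof -
  have U: "orthonormal_mat m U" and V: "orthonormal_mat n V" and S: "S \<in> carrier_mat m n" 
    and X: "X = U * S * V\<^sup>T" using svd by (auto simp: full_svd_def)
  note u = orthonormal_matD[OF U] and v = orthonormal_matD[OF V]
  have us: "U * S \<in> carrier_mat m n" and ut: "U\<^sup>T \<in> carrier_mat m m" and vt: "V\<^sup>T \<in> carrier_mat n n"
    using u(1) S v(1) by auto
  have "U\<^sup>T * X = U\<^sup>T * (U * S) * V\<^sup>T" unfolding X by (rule assoc_mult_mat[OF ut us vt, symmetric])
  also have "U\<^sup>T * (U * S) = U\<^sup>T * U * S" by (rule assoc_mult_mat[OF ut u(1) S, symmetric])
  also have "\<dots> = S" unfolding u(2) using S by simp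
  finally have "U\<^sup>T * X * V = S * V\<^sup>T * V" by simp
  also have "\<dots> = S * (V\<^sup>T * V)" by (rule assoc_mult_mat[OF S vt v(1)])
  finally show ?thesis unfolding v(2) using S by simp
qed

theorem proposition5p9:
  fixes m n k t s :: nat
    and A :: "dual mat"
    and As Ai U S V U1 U2 U1' V1 V2 M N :: "real mat"
  assumes "n \<le> m" and "1 \<le> k" and "k \<le> n"
    and "A \<in> carrier_mat m n"
    and "As = st_mat A" and "Ai = nst_mat A"
    and "As \<noteq> 0\<^sub>m m n \<Longrightarrow> 1 \<le> t \<and> t \<le> k \<and>
           {k - t + 1 .. k + s} = {j \<in> {1..n}. singular_value As j = singular_value As k}"
    and "As \<noteq> 0\<^sub>m m n \<Longrightarrow> full_svd m n As U S V"
    and "U1 = col_range U 1 (k - t)"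
    and "U2 = col_range U (k - t + 1) (k + s)"
    and "U1' = col_range U (k - t + 1) m"
    and "V1 = col_range V 1 (k - t)"
    and "V2 = col_range V (k - t + 1) (k + s)"
    and "M = sym_part (U2\<^sup>T * Ai * V2)"
    and "N = U1'\<^sup>T * Ai * V2"
  shows "gateaux_exists (ky_fan_norm k) Ai As \<and>
    dual_continuation (ky_fan_norm k) A =
      (if As \<noteq> 0\<^sub>m m n \<and> singular_value As k \<noteq> 0 then
         of_real (ky_fan_norm k As) +
         of_real (mat_inner (U1 * V1\<^sup>T) Ai + (\<Sum>l = 1..t. eigenvalue_desc M l)) * \<epsilon>
       else if As \<noteq> 0\<^sub>m m n \<and> singular_value As k = 0 then
         of_real (ky_fan_norm k As) +
         of_real (mat_inner (U1 * V1\<^sup>T) Ai + (\<Sum>l = 1..t. singular_value N l)) * \<epsilon>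
       else of_real (ky_fan_norm k Ai) * \<epsilon>)"
proof -
  have As: "As \<in> carrier_mat m n" and Ai: "Ai \<in> carrier_mat m n" using assms(4,5,6) by auto
  note k = assms(2,3)
  have cont: "gateaux_exists (ky_fan_norm k) Ai As \<and>
      dual_continuation (ky_fan_norm k) A = of_real (ky_fan_norm k As) + of_real D * \<epsilon>"
    if "(gateaux_quotient (ky_fan_norm k) Ai As \<longlongrightarrow> D) (at_right 0)" for D
    using gateaux_derivI[OF that] unfolding dual_continuation_def assms(5,6) by simp
  show ?thesis
  proof (cases "As = 0\<^sub>m m n")
    case True
    have "(gateaux_quotient (ky_fan_norm k) Ai As \<longlongrightarrow> ky_fan_norm k Ai) (at_right 0)"
      unfolding True by (rule ky_fan_quotient_at_zero(1)[OF Ai k])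
    from cont[OF this] show ?thesis using ky_fan_quotient_at_zero(2)[OF Ai k] True by simp
  next
    case False
    define r where "r = k - t"
    define q where "q = k + s"
    define h where "h = singular_value As k"
    define f where "f i = singular_value As (Suc i)" for i
    have t: "1 \<le> t" "t \<le> k" and level: "{Suc r .. q} = {j \<in> {1..n}. singular_value As j = h}"
      using assms(7)[OF False] by (auto simp: r_def q_def h_def)
    have svd: "full_svd m n As U S V" by (rule assms(8)[OF False])
    then have U: "orthonormal_mat m U" and V: "orthonormal_mat n V" and S: "S \<in> carrier_mat m n"
      and diag: "diagonal_mat S" and Sf: "\<forall>j < min m n. S $$ (j, j) = f j"
      by (auto simp: full_svd_def f_def)
    note Uc = orthonormal_matD(1)[OF U] and Vc = orthonormal_matD(1)[OF V]
    have rk: "r < k" and kq: "k \<le> q" and kr: "k - r = t" using t by (auto simp: r_def q_def)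
    have "q \<in> {Suc r .. q}" using rk kq by simp
    then have qn: "q \<le> n" unfolding level by simp
    have in_level: "f i = h \<longleftrightarrow> r \<le> i \<and> i < q" if "i < n" for i
    proof -
      have "Suc i \<in> {Suc r .. q} \<longleftrightarrow> f i = h" unfolding level using that by (simp add: f_def)
      then show ?thesis by auto
    qed
    have anti: "f j \<le> f i" if "i \<le> j" "j < n" for i j
      unfolding f_def by (rule singular_value_antimono[OF As that])
    have f0: "0 \<le> f i" if "i < n" for i unfolding f_def by (rule singular_value_nonneg[OF As that])
    have hk: "h = f (k - 1)" using k by (simp add: h_def f_def)
    have h0: "0 \<le> h" unfolding hk using k by (intro f0) simp
    obtain g where g: "0 < g" "g \<le> 1" "h \<noteq> 0 \<Longrightarrow> g \<le> h" and
      gap: "\<And>i. i < n \<Longrightarrow> f i \<noteq> h \<Longrightarrow> g \<le> \<bar>f i - h\<bar>"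
      using exists_singular_gap[OF h0, of n f] by blast
    interpret singular_block m n r q k f h g
    proof
      show "n \<le> m" "r < k" "k \<le> q" "q \<le> n" "0 \<le> h" "0 < g" "g \<le> 1" by fact+
      show "h \<noteq> 0 \<Longrightarrow> g \<le> h" by fact
      show "h + g \<le> f i" if "i < r" for i
        using gap[of i] in_level[of i] anti[of i "k - 1"] that rk k hk by simp
      show "f i = h" if "r \<le> i" "i < q" for i using in_level[of i] that qn by simp
      show "f i \<le> h - g" if "q \<le> i" "i < n" for i
        using gap[of i] in_level[of i] anti[of "k - 1" i] that kq k hk by simp
      show "0 \<le> f i" if "i < n" for i by (rule f0[OF that])
    qed
    define B where "B = U\<^sup>T * Ai * V"
    have B: "B \<in> carrier_mat m n" using Uc Vc Ai by (simp add: B_def)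
    have Seq: "U\<^sup>T * As * V = S" by (rule full_svd_rotate[OF svd])
    have Sd: "S $$ (i, j) = (if i = j then f i else 0)" if "i < m" "j < n" for i j
      using diag S Sf that unfolding diagonal_mat_def by auto
    have norm: "ky_fan_norm k S = (\<Sum>i<k. f i)"
      using ky_fan_norm_orthogonal_invariant[OF As U V, of k] unfolding Seq
      by (simp only: ky_fan_norm_eq[of k As] f_def)
    have quot: "gateaux_quotient (ky_fan_norm k) B S = gateaux_quotient (ky_fan_norm k) Ai As"
      unfolding B_def Seq[symmetric] by (rule ky_fan_quotient_orthogonal_invariant[OF As Ai U V])
    have inner: "mat_inner (U1 * V1\<^sup>T) Ai = (\<Sum>i<r. B $$ (i, i))"
      unfolding assms(9,12) B_def r_def[symmetric]
      using rk k assms(1) by (intro mat_inner_col_range[OF Uc Ai Vc]) auto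
    have U2: "U2 = col_range U (Suc r) q" and V2: "V2 = col_range V (Suc r) q"
      and U1': "U1' = col_range U (Suc r) m"
      unfolding assms(10,11,13) r_def q_def by simp_all
    have U2c: "U2 \<in> carrier_mat m (q - r)" and V2c: "V2 \<in> carrier_mat n (q - r)"
      and U1c: "U1' \<in> carrier_mat m (m - r)"
      unfolding U2 V2 U1' by (rule col_range_carrier[OF Uc] col_range_carrier[OF Vc])+
    have shift: "(\<Sum>l = 1..t. F l) = (\<Sum>l<t. F (Suc l))" for F :: "nat \<Rightarrow> real"
      by (rule sum.reindex_bij_witness[of _ Suc "\<lambda>i. i - 1"]) auto
    show ?thesis
    proof (cases "h = 0")
      case hnz: False
      let ?Z = "U2\<^sup>T * Ai * V2"
      have Z: "?Z \<in> carrier_mat (q - r) (q - r)" using U2c V2c Ai by simp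
      have Zi: "?Z $$ (i, j) = B $$ (r + i, r + j)" if "i < q - r" "j < q - r" for i j
        unfolding U2 V2 B_def using that qn assms(1)
        by (intro col_range_compression_index[OF Uc Ai Vc]) auto
      have M: "M \<in> carrier_mat (q - r) (q - r)" unfolding assms(14) sym_part_def using Z by simp
      have Mi: "M $$ (i, j) = (B $$ (r + i, r + j) + B $$ (r + j, r + i)) / 2"
        if "i < q - r" "j < q - r" for i j
        using Z that Zi[OF that] Zi[OF that(2,1)] unfolding assms(14) sym_part_def
        by (simp del: index_mult_mat)
      have "(gateaux_quotient (ky_fan_norm k) Ai As \<longlongrightarrow>
          mat_inner (U1 * V1\<^sup>T) Ai + (\<Sum>l = 1..t. eigenvalue_desc M l)) (at_right 0)"
        using ky_fan_directional_limit_positive_level[OF S B Sd norm hnz M Mi]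
        unfolding quot inner shift kr .
      from cont[OF this] show ?thesis using False hnz unfolding h_def by simp
    next
      case hz: True
      \<comment> \<open>At level 0 all later singular values vanish too, so the middle block extends to the last column.\<close>
      have "f (n - 1) = 0" using anti[of "k - 1" "n - 1"] f0[of "n - 1"] hk hz k by simp
      then have "n - 1 < q" using in_level[of "n - 1"] hz k by simp
      then have q: "q = n" using qn by simp
      have N: "N \<in> carrier_mat (m - r) (n - r)" unfolding assms(15) using U1c V2c Ai q by simp
      have Ni: "N $$ (i, j) = B $$ (r + i, r + j)" if "i < m - r" "j < n - r" for i j
        unfolding assms(15) U1' V2 B_def q using that
        by (intro col_range_compression_index[OF Uc Ai Vc]) auto
      have "(gateaux_quotient (ky_fan_norm k) Ai As \<longlongrightarrow>
          mat_inner (U1 * V1\<^sup>T) Ai + (\<Sum>l = 1..t. singular_value N l)) (at_right 0)"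
        using ky_fan_directional_limit_zero_level[OF S B Sd norm hz q N Ni]
        unfolding quot inner kr ky_fan_norm_eq shift .
      from cont[OF this] show ?thesis using False hz unfolding h_def by simp
    qed
  qed
qed

end
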